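(* $\exists\mathbb{R}_{\operatorname{ECF}}$ is contained in $\Sigma^0_3$.
   Context: A function $f\colon\mathbb{R}^n\to\mathbb{R}$ is effectively continuous if there is a computable function $g$ such that: (1) to each $n$-tuple of open intervals $(a_1,b_1),\dots,(a_n,b_n)$ with rational endpoints, $g$ associates an open interval $(c,d)$ with rational endpoints with $f(x)\in(c,d)$ for all $x\in\prod_i(a_i,b_i)$; (2) for all $M>0$, $\varepsilon>0$ there is $\delta>0$ such that whenever all $(a_i,b_i)\subseteq[-M,M]$ and $|a_i-b_i|<\delta$, the output $(c,d)$ of $g$ satisfies $|c-d|<\varepsilon$. $\operatorname{ECF}$ is the set of all effectively continuous functions (each referred to by a code of a computable $g$ computing it). $\mathbb{R}_{\operatorname{ECF}}$ is $(\mathbb{R},+,\times,<,=,0,1)$ expanded by function symbols for all functions in $\operatorname{ECF}$. $\exists\mathbb{R}_{\operatorname{ECF}}$ is the class of decision problems polynomial-time many-one reducible to the set of existential sentences (atoms $t<t'$, $t=t'$, connectives $\land,\lor$, quantifier $\exists$ only) true in $\mathbb{R}_{\operatorname{ECF}}$. $\Sigma^0_3$ is the third existential level of the arithmetical hierarchy.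
   Formalization: Reductions must output existential sentences whose function symbols all carry valid codes of effectively continuous functions; if invalid codes could be output and counted as no-instances, the set of true sentences would be Π⁰₃-hard and the containment would fail. *)

theory Defs
  imports Complex_Main "HOL-Computational_Algebra.Polynomial"
begin

section \<open>Turing machines and polynomial time\<close>

text \<open>
  A machine is a finite table of instructions ((state, symbol), (state, symbol, move)) on one
  two-way infinite tape; it starts in state 0 and halts when no instruction applies.
  Symbol 0 is the blank, 1 and 2 stand for the bits False and True, and larger numbers are
  available as work symbols.  If a pair (state, symbol) occurs several times, the first
  instruction counts, so every machine is deterministic.
\<close>

datatype move = GoLeft | GoRight | Stay

type_synonym tm = "((nat \<times> nat) \<times> (nat \<times> nat \<times> move)) list"

text \<open>State, tape to the left of the head (nearest cell first), tape from the head onwards.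
  Both tape halves are continued by blanks.\<close>

type_synonym config = "nat \<times> nat list \<times> nat list"

definition cell :: "nat list \<Rightarrow> nat" where
  "cell xs = (case xs of [] \<Rightarrow> 0 | s # _ \<Rightarrow> s)"

fun tm_step :: "tm \<Rightarrow> config \<Rightarrow> config option" where
  "tm_step M (q, l, r) =
     (case map_of M (q, cell r) of
        None \<Rightarrow> None
      | Some (q', s, m) \<Rightarrow>
          Some (case m of
                  GoLeft \<Rightarrow> (q', tl l, cell l # s # tl r)
                | GoRight \<Rightarrow> (q', s # l, tl r)
                | Stay \<Rightarrow> (q', l, s # tl r)))"

definition tm_init :: "bool list \<Rightarrow> config" where
  "tm_init w = (0, [], map (\<lambda>b. if b then 2 else 1) w)"

fun tm_output :: "config \<Rightarrow> bool list" where
  "tm_output (q, l, r) = map (\<lambda>s. s = 2) (takeWhile (\<lambda>s. s = 1 \<or> s = 2) r)"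

definition tm_computes_in :: "tm \<Rightarrow> nat \<Rightarrow> bool list \<Rightarrow> bool list \<Rightarrow> bool" where
  "tm_computes_in M k w v \<longleftrightarrow>
     (\<exists>c. ((\<lambda>c c'. tm_step M c = Some c') ^^ k) (tm_init w) c
        \<and> tm_step M c = None \<and> tm_output c = v)"

definition tm_computes :: "tm \<Rightarrow> bool list \<Rightarrow> bool list \<Rightarrow> bool" where
  "tm_computes M w v \<longleftrightarrow> (\<exists>k. tm_computes_in M k w v)"

definition poly_time :: "(bool list \<Rightarrow> bool list) \<Rightarrow> bool" where
  "poly_time f \<longleftrightarrow>
     (\<exists>M. \<exists>p :: nat poly. \<forall>w. \<exists>k \<le> poly p (length w). tm_computes_in M k w (f w))"

lemma tm_run_deterministic:
  assumes "((\<lambda>c c'. tm_step M c = Some c') ^^ j) c a" "tm_step M a = None"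
    and "((\<lambda>c c'. tm_step M c = Some c') ^^ k) c b" "tm_step M b = None"
  shows "a = b"
  using assms
proof (induction j arbitrary: c k)
  case 0
  then show ?case by (cases k) (auto elim: relpowp_E2)
next
  case (Suc j)
  from Suc.prems(1) obtain d where d: "tm_step M c = Some d"
    "((\<lambda>c c'. tm_step M c = Some c') ^^ j) d a"
    using relpowp_Suc_D2[OF Suc.prems(1)] by blast
  show ?case
  proof (cases k)
    case 0
    then show ?thesis using Suc.prems d by auto
  next
    case (Suc k')
    then have "((\<lambda>c c'. tm_step M c = Some c') ^^ k') d b"
      using relpowp_Suc_D2[of k' _ c b] Suc.prems(3) d(1) by fastforce
    then show ?thesis using Suc.IH d(2) Suc.prems by blast
  qed
qed

lemma tm_computes_unique: "tm_computes M w v \<Longrightarrow> tm_computes M w v' \<Longrightarrow> v = v'"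
  unfolding tm_computes_def tm_computes_in_def using tm_run_deterministic by metis


section \<open>Bit string encodings\<close>

text \<open>All encoders below are prefix-free.  A number is written in bijective base 2, least
  significant digit first, every digit being announced by True; False ends the number.\<close>

fun enc_nat :: "nat \<Rightarrow> bool list" where
  "enc_nat n = (if n = 0 then [False] else True # even n # enc_nat ((n - 1) div 2))"

declare enc_nat.simps [simp del]

definition enc_rat :: "rat \<Rightarrow> bool list" where
  "enc_rat q = (case quotient_of q of
     (a, b) \<Rightarrow> (a < 0) # enc_nat (nat \<bar>a\<bar>) @ enc_nat (nat b))"

definition enc_interval :: "rat \<times> rat \<Rightarrow> bool list" where
  "enc_interval I = enc_rat (fst I) @ enc_rat (snd I)"

definition enc_list :: "bool list list \<Rightarrow> bool list" where
  "enc_list ws = concat (map (\<lambda>w. True # w) ws) @ [False]"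

definition enc_box :: "(rat \<times> rat) list \<Rightarrow> bool list" where
  "enc_box B = enc_list (map enc_interval B)"

fun enc_move :: "move \<Rightarrow> bool list" where
  "enc_move GoLeft = [False, False]"
| "enc_move GoRight = [False, True]"
| "enc_move Stay = [True, False]"

fun enc_instr :: "(nat \<times> nat) \<times> (nat \<times> nat \<times> move) \<Rightarrow> bool list" where
  "enc_instr ((q, s), (q', s', m)) =
     enc_nat q @ enc_nat s @ enc_nat q' @ enc_nat s' @ enc_move m"

definition enc_tm :: "tm \<Rightarrow> bool list" where
  "enc_tm M = enc_list (map enc_instr M)"


section \<open>Effectively continuous functions\<close>

text \<open>Points of n-space are real lists of length n; an n-tuple of open intervals with rational
  endpoints is a list of n pairs (a, b) with a < b.\<close>

definition is_box :: "nat \<Rightarrow> (rat \<times> rat) list \<Rightarrow> bool" where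
  "is_box n B \<longleftrightarrow> length B = n \<and> (\<forall>(a, b) \<in> set B. a < b)"

definition in_box :: "real list \<Rightarrow> (rat \<times> rat) list \<Rightarrow> bool" where
  "in_box xs B \<longleftrightarrow> list_all2 (\<lambda>x (a, b). x \<in> {of_rat a <..< of_rat b}) xs B"

text \<open>A code of f is a Turing machine computing a function G on n-tuples of intervals that has the
  two defining properties of effective continuity.  (For n = 0 no f has a code, since the second
  property would require intervals of every positive length at once.)\<close>

definition ecf_code :: "tm \<Rightarrow> nat \<Rightarrow> (real list \<Rightarrow> real) \<Rightarrow> bool" where
  "ecf_code g n f \<longleftrightarrow>
     (\<exists>G :: (rat \<times> rat) list \<Rightarrow> rat \<times> rat.
        (\<forall>B. is_box n B \<longrightarrow> tm_computes g (enc_box B) (enc_interval (G B))) \<and>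
        (\<forall>B. is_box n B \<longrightarrow>
           (\<forall>xs. in_box xs B \<longrightarrow> f xs \<in> {of_rat (fst (G B)) <..< of_rat (snd (G B))})) \<and>
        (\<forall>M > (0::real). \<forall>\<epsilon> > (0::real). \<exists>\<delta> > (0::real). \<forall>B.
           is_box n B \<and>
           (\<forall>(a, b) \<in> set B. {of_rat a <..< of_rat b} \<subseteq> {-M..M}
                             \<and> \<bar>of_rat a - of_rat b\<bar> < \<delta>) \<longrightarrow>
           \<bar>of_rat (fst (G B)) - of_rat (snd (G B))\<bar> < \<epsilon>))"

text \<open>The function with code g; on lists of length n it is unique (proved at the end).\<close>

definition ecf_fun :: "tm \<Rightarrow> nat \<Rightarrow> real list \<Rightarrow> real" where
  "ecf_fun g n = (SOME f. ecf_code g n f)"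


section \<open>Existential sentences over the reals with effectively continuous functions\<close>

text \<open>The function symbols are pairs of a code and an arity; the arity is given by the number of
  arguments.\<close>

datatype ecf_term =
    Var nat | Zero | One
  | Add ecf_term ecf_term
  | Mul ecf_term ecf_term
  | Fun tm "ecf_term list"

datatype ecf_form =
    Less ecf_term ecf_term
  | Equal ecf_term ecf_term
  | Conj ecf_form ecf_form
  | Disj ecf_form ecf_form
  | Exists nat ecf_form

fun term_vars :: "ecf_term \<Rightarrow> nat set" where
  "term_vars (Var x) = {x}"
| "term_vars Zero = {}"
| "term_vars One = {}"
| "term_vars (Add s t) = term_vars s \<union> term_vars t"
| "term_vars (Mul s t) = term_vars s \<union> term_vars t"
| "term_vars (Fun g ts) = (\<Union>t \<in> set ts. term_vars t)"

primrec free_vars :: "ecf_form \<Rightarrow> nat set" where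
  "free_vars (Less s t) = term_vars s \<union> term_vars t"
| "free_vars (Equal s t) = term_vars s \<union> term_vars t"
| "free_vars (Conj \<phi> \<psi>) = free_vars \<phi> \<union> free_vars \<psi>"
| "free_vars (Disj \<phi> \<psi>) = free_vars \<phi> \<union> free_vars \<psi>"
| "free_vars (Exists x \<phi>) = free_vars \<phi> - {x}"

fun wf_term :: "ecf_term \<Rightarrow> bool" where
  "wf_term (Var x) \<longleftrightarrow> True"
| "wf_term Zero \<longleftrightarrow> True"
| "wf_term One \<longleftrightarrow> True"
| "wf_term (Add s t) \<longleftrightarrow> wf_term s \<and> wf_term t"
| "wf_term (Mul s t) \<longleftrightarrow> wf_term s \<and> wf_term t"
| "wf_term (Fun g ts) \<longleftrightarrow> (\<exists>f. ecf_code g (length ts) f) \<and> (\<forall>t \<in> set ts. wf_term t)"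

primrec wf_form :: "ecf_form \<Rightarrow> bool" where
  "wf_form (Less s t) \<longleftrightarrow> wf_term s \<and> wf_term t"
| "wf_form (Equal s t) \<longleftrightarrow> wf_term s \<and> wf_term t"
| "wf_form (Conj \<phi> \<psi>) \<longleftrightarrow> wf_form \<phi> \<and> wf_form \<psi>"
| "wf_form (Disj \<phi> \<psi>) \<longleftrightarrow> wf_form \<phi> \<and> wf_form \<psi>"
| "wf_form (Exists x \<phi>) \<longleftrightarrow> wf_form \<phi>"

definition ecf_sentence :: "ecf_form \<Rightarrow> bool" where
  "ecf_sentence \<phi> \<longleftrightarrow> wf_form \<phi> \<and> free_vars \<phi> = {}"

primrec term_val :: "(nat \<Rightarrow> real) \<Rightarrow> ecf_term \<Rightarrow> real" where
  "term_val e (Var x) = e x"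
| "term_val e Zero = 0"
| "term_val e One = 1"
| "term_val e (Add s t) = term_val e s + term_val e t"
| "term_val e (Mul s t) = term_val e s * term_val e t"
| "term_val e (Fun g ts) = ecf_fun g (length ts) (map (term_val e) ts)"

primrec holds :: "(nat \<Rightarrow> real) \<Rightarrow> ecf_form \<Rightarrow> bool" where
  "holds e (Less s t) \<longleftrightarrow> term_val e s < term_val e t"
| "holds e (Equal s t) \<longleftrightarrow> term_val e s = term_val e t"
| "holds e (Conj \<phi> \<psi>) \<longleftrightarrow> holds e \<phi> \<and> holds e \<psi>"
| "holds e (Disj \<phi> \<psi>) \<longleftrightarrow> holds e \<phi> \<or> holds e \<psi>"
| "holds e (Exists x \<phi>) \<longleftrightarrow> (\<exists>v. holds (e(x := v)) \<phi>)"

definition true_sentence :: "ecf_form \<Rightarrow> bool" where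
  "true_sentence \<phi> \<longleftrightarrow> ecf_sentence \<phi> \<and> (\<forall>e. holds e \<phi>)"

primrec enc_term :: "ecf_term \<Rightarrow> bool list" where
  "enc_term (Var x) = [False, False, False] @ enc_nat x"
| "enc_term Zero = [False, False, True]"
| "enc_term One = [False, True, False]"
| "enc_term (Add s t) = [False, True, True] @ enc_term s @ enc_term t"
| "enc_term (Mul s t) = [True, False, False] @ enc_term s @ enc_term t"
| "enc_term (Fun g ts) = [True, False, True] @ enc_tm g @ enc_list (map enc_term ts)"

primrec enc_form :: "ecf_form \<Rightarrow> bool list" where
  "enc_form (Less s t) = [False, False, False] @ enc_term s @ enc_term t"
| "enc_form (Equal s t) = [False, False, True] @ enc_term s @ enc_term t"
| "enc_form (Conj \<phi> \<psi>) = [False, True, False] @ enc_form \<phi> @ enc_form \<psi>"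
| "enc_form (Disj \<phi> \<psi>) = [False, True, True] @ enc_form \<phi> @ enc_form \<psi>"
| "enc_form (Exists x \<phi>) = [True, False, False] @ enc_nat x @ enc_form \<phi>"


section \<open>The class of problems reducible to the existential theory\<close>

text \<open>A problem is given by its set of instances and its set of yes-instances.  A reduction has to
  produce instances.  This matters here: the instances are the existential sentences of the
  language, and whether a Turing machine is the code of an effectively continuous function,
  i.e. is a function symbol at all, is undecidable.\<close>

definition poly_reducible :: "bool list set \<Rightarrow> bool list set \<Rightarrow> bool list set \<Rightarrow> bool" where
  "poly_reducible L Inst Yes \<longleftrightarrow>
     (\<exists>r. poly_time r \<and> (\<forall>w. r w \<in> Inst) \<and> (\<forall>w. w \<in> L \<longleftrightarrow> r w \<in> Yes))"

definition ExistsR_ECF :: "bool list set set" where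
  "ExistsR_ECF = {L. poly_reducible L (enc_form ` {\<phi>. ecf_sentence \<phi>})
                                  (enc_form ` {\<phi>. true_sentence \<phi>})}"


section \<open>The arithmetical hierarchy\<close>

datatype arith_term =
    AVar nat | AZero
  | ASuc arith_term
  | AAdd arith_term arith_term
  | AMul arith_term arith_term

text \<open>In ABall x t \<phi> and ABex x t \<phi>, the bounded quantifiers over x < t, the bound t is
  outside the scope of x.\<close>

datatype arith_form =
    ALess arith_term arith_term
  | AEqual arith_term arith_term
  | ANeg arith_form
  | AConj arith_form arith_form
  | ADisj arith_form arith_form
  | ABall nat arith_term arith_form
  | ABex nat arith_term arith_form
  | AAll nat arith_form
  | AEx nat arith_form

primrec arith_val :: "(nat \<Rightarrow> nat) \<Rightarrow> arith_term \<Rightarrow> nat" where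
  "arith_val e (AVar x) = e x"
| "arith_val e AZero = 0"
| "arith_val e (ASuc t) = Suc (arith_val e t)"
| "arith_val e (AAdd s t) = arith_val e s + arith_val e t"
| "arith_val e (AMul s t) = arith_val e s * arith_val e t"

primrec arith_holds :: "(nat \<Rightarrow> nat) \<Rightarrow> arith_form \<Rightarrow> bool" where
  "arith_holds e (ALess s t) \<longleftrightarrow> arith_val e s < arith_val e t"
| "arith_holds e (AEqual s t) \<longleftrightarrow> arith_val e s = arith_val e t"
| "arith_holds e (ANeg \<phi>) \<longleftrightarrow> \<not> arith_holds e \<phi>"
| "arith_holds e (AConj \<phi> \<psi>) \<longleftrightarrow> arith_holds e \<phi> \<and> arith_holds e \<psi>"
| "arith_holds e (ADisj \<phi> \<psi>) \<longleftrightarrow> arith_holds e \<phi> \<or> arith_holds e \<psi>"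
| "arith_holds e (ABall x t \<phi>) \<longleftrightarrow> (\<forall>v < arith_val e t. arith_holds (e(x := v)) \<phi>)"
| "arith_holds e (ABex x t \<phi>) \<longleftrightarrow> (\<exists>v < arith_val e t. arith_holds (e(x := v)) \<phi>)"
| "arith_holds e (AAll x \<phi>) \<longleftrightarrow> (\<forall>v. arith_holds (e(x := v)) \<phi>)"
| "arith_holds e (AEx x \<phi>) \<longleftrightarrow> (\<exists>v. arith_holds (e(x := v)) \<phi>)"

primrec bounded_form :: "arith_form \<Rightarrow> bool" where
  "bounded_form (ALess s t) \<longleftrightarrow> True"
| "bounded_form (AEqual s t) \<longleftrightarrow> True"
| "bounded_form (ANeg \<phi>) \<longleftrightarrow> bounded_form \<phi>"
| "bounded_form (AConj \<phi> \<psi>) \<longleftrightarrow> bounded_form \<phi> \<and> bounded_form \<psi>"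
| "bounded_form (ADisj \<phi> \<psi>) \<longleftrightarrow> bounded_form \<phi> \<and> bounded_form \<psi>"
| "bounded_form (ABall x t \<phi>) \<longleftrightarrow> bounded_form \<phi>"
| "bounded_form (ABex x t \<phi>) \<longleftrightarrow> bounded_form \<phi>"
| "bounded_form (AAll x \<phi>) \<longleftrightarrow> False"
| "bounded_form (AEx x \<phi>) \<longleftrightarrow> False"

inductive sigma_form :: "nat \<Rightarrow> arith_form \<Rightarrow> bool"
  and pi_form :: "nat \<Rightarrow> arith_form \<Rightarrow> bool" where
  "bounded_form \<phi> \<Longrightarrow> sigma_form 0 \<phi>"
| "bounded_form \<phi> \<Longrightarrow> pi_form 0 \<phi>"
| "pi_form n \<phi> \<Longrightarrow> sigma_form (Suc n) \<phi>"
| "sigma_form (Suc n) \<phi> \<Longrightarrow> sigma_form (Suc n) (AEx x \<phi>)"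
| "sigma_form n \<phi> \<Longrightarrow> pi_form (Suc n) \<phi>"
| "pi_form (Suc n) \<phi> \<Longrightarrow> pi_form (Suc n) (AAll x \<phi>)"

definition sigma_set :: "nat \<Rightarrow> nat set \<Rightarrow> bool" where
  "sigma_set n S \<longleftrightarrow>
     (\<exists>\<phi>. sigma_form n \<phi> \<and> (\<forall>e. arith_holds e \<phi> \<longleftrightarrow> e 0 \<in> S))"

text \<open>The bijection between bit strings and numbers given by bijective base 2.\<close>

primrec str_code :: "bool list \<Rightarrow> nat" where
  "str_code [] = 0"
| "str_code (b # w) = 2 * str_code w + (if b then 2 else 1)"

definition Sigma0 :: "nat \<Rightarrow> bool list set set" where
  "Sigma0 n = {L. sigma_set n (str_code ` L)}"


section \<open>Sanity checks\<close>

lemma bij_str_code: "bij str_code"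
proof (rule bijI)
  show "inj str_code"
  proof (rule injI)
    fix v w show "str_code v = str_code w \<Longrightarrow> v = w"
    proof (induction v arbitrary: w)
      case Nil
      then show ?case by (cases w) (auto split: if_splits)
    next
      case (Cons b v)
      then obtain c u where w: "w = c # u" by (cases w) (auto split: if_splits)
      have "b = c \<and> str_code v = str_code u"
        using Cons.prems unfolding w by (cases b; cases c; simp; presburger)
      then show ?case using Cons.IH w by simp
    qed
  qed
  have "\<exists>w. n = str_code w" for n
  proof (induction n rule: less_induct)
    case (less n)
    show ?case
    proof (cases "n = 0")
      case True
      then show ?thesis by (intro exI[of _ "[]"]) simp
    next
      case False
      then have "(n - 1) div 2 < n" by simp
      then obtain w where w: "(n - 1) div 2 = str_code w" using less by blast
      have "n = str_code (even n # w)"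
        using False w by (cases "even n"; simp; presburger)
      then show ?thesis by blast
    qed
  qed
  then show "surj str_code" by (auto simp: surj_def)
qed

lemma enc_nat_prefix: "enc_nat m @ u = enc_nat n @ v \<longleftrightarrow> m = n \<and> u = v"
proof (induction m arbitrary: n rule: less_induct)
  case (less m)
  have step: "enc_nat k = True # even k # enc_nat ((k - 1) div 2)" if "k \<noteq> 0" for k
    using that by (subst enc_nat.simps) simp
  have zero: "enc_nat 0 = [False]" by (subst enc_nat.simps) simp
  show ?case
  proof (cases "m = 0 \<or> n = 0")
    case True
    then show ?thesis using step[of m] step[of n] zero by (cases "m = 0"; cases "n = 0"; auto)
  next
    case False
    then have lt: "(m - 1) div 2 < m" by presburger
    have "m = n" if "(m - 1) div 2 = (n - 1) div 2" "even m = even n"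
      using that False by presburger
    then show ?thesis using less[OF lt] step[of m] step[of n] False by auto
  qed
qed

lemma enc_move_prefix: "enc_move m @ u = enc_move n @ v \<longleftrightarrow> m = n \<and> u = v"
  by (cases m; cases n) auto

lemma enc_instr_prefix: "enc_instr i @ u = enc_instr j @ v \<longleftrightarrow> i = j \<and> u = v"
  by (cases i rule: enc_instr.cases; cases j rule: enc_instr.cases)
     (auto simp: enc_nat_prefix enc_move_prefix)

lemma enc_list_Nil: "enc_list [] = [False]"
  and enc_list_Cons: "enc_list (w # ws) = True # w @ enc_list ws"
  by (simp_all add: enc_list_def)

lemma enc_list_prefix:
  assumes "\<And>x y u v. x \<in> set xs \<Longrightarrow> f x @ u = f y @ v \<longleftrightarrow> x = y \<and> u = v"
  shows "enc_list (map f xs) @ u = enc_list (map f ys) @ v \<longleftrightarrow> xs = ys \<and> u = v"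
  using assms
proof (induction xs arbitrary: ys)
  case Nil
  then show ?case by (cases ys) (auto simp: enc_list_Nil enc_list_Cons)
next
  case (Cons x xs)
  then show ?case by (cases ys) (auto simp: enc_list_Nil enc_list_Cons)
qed

lemma enc_tm_prefix: "enc_tm g @ u = enc_tm h @ v \<longleftrightarrow> g = h \<and> u = v"
  unfolding enc_tm_def by (rule enc_list_prefix) (rule enc_instr_prefix)

lemma enc_term_prefix: "enc_term s @ u = enc_term t @ v \<longleftrightarrow> s = t \<and> u = v"
proof (induction s arbitrary: t u v)
  case (Var x)
  then show ?case by (cases t) (auto simp: enc_nat_prefix)
next
  case (Fun g ts)
  have "enc_list (map enc_term ts) @ u = enc_list (map enc_term ts') @ v \<longleftrightarrow> ts = ts' \<and> u = v" for ts'
    using Fun by (intro enc_list_prefix) blast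
  then show ?case by (cases t) (auto simp: enc_tm_prefix)
next
  case Zero
  show ?case by (cases t) simp_all
next
  case One
  show ?case by (cases t) simp_all
next
  case (Add s1 s2)
  then show ?case by (cases t) simp_all
next
  case (Mul s1 s2)
  then show ?case by (cases t) simp_all
qed

lemma enc_form_prefix: "enc_form \<phi> @ u = enc_form \<psi> @ v \<longleftrightarrow> \<phi> = \<psi> \<and> u = v"
proof (induction \<phi> arbitrary: \<psi> u v)
  case (Less s t)
  show ?case by (cases \<psi>) (simp_all add: enc_term_prefix)
next
  case (Equal s t)
  show ?case by (cases \<psi>) (simp_all add: enc_term_prefix)
next
  case (Conj \<phi>1 \<phi>2)
  then show ?case by (cases \<psi>) simp_all
next
  case (Disj \<phi>1 \<phi>2)
  then show ?case by (cases \<psi>) simp_all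
next
  case (Exists x \<phi>)
  then show ?case by (cases \<psi>) (simp_all add: enc_nat_prefix)
qed

lemma inj_enc_form: "inj enc_form"
  by (metis (no_types, lifting) enc_form_prefix injI)

lemma enc_rat_prefix: "enc_rat p @ u = enc_rat q @ v \<longleftrightarrow> p = q \<and> u = v"
proof -
  obtain a b where p: "quotient_of p = (a, b)" by (cases "quotient_of p")
  obtain c d where q: "quotient_of q = (c, d)" by (cases "quotient_of q")
  have pos: "b > 0" "d > 0" using p q quotient_of_denom_pos by blast+
  have "p = q \<longleftrightarrow> a = c \<and> b = d"
    using p q quotient_of_inject_eq[of p q] by simp
  moreover have "a = c \<longleftrightarrow> (a < 0) = (c < 0) \<and> nat \<bar>a\<bar> = nat \<bar>c\<bar>" by linarith
  moreover have "b = d \<longleftrightarrow> nat b = nat d" using pos by linarith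
  ultimately show ?thesis
    unfolding enc_rat_def p q prod.case append_Cons append_assoc list.inject enc_nat_prefix
    by (simp only: conj_assoc)
qed

lemma inj_enc_interval: "inj enc_interval"
proof (rule injI)
  fix I J assume "enc_interval I = enc_interval J"
  then show "I = J"
    unfolding enc_interval_def using enc_rat_prefix[of "snd I" "[]" "snd J" "[]"]
    by (auto simp: enc_rat_prefix prod_eq_iff)
qed

lemma inj_enc_box: "inj enc_box"
proof (rule injI)
  fix B C assume "enc_box B = enc_box C"
  moreover have "enc_interval I @ u = enc_interval J @ v \<longleftrightarrow> I = J \<and> u = v" for I J u v
    by (auto simp: enc_interval_def enc_rat_prefix prod_eq_iff)
  ultimately show "B = C"
    using enc_list_prefix[of B enc_interval "[]" C "[]"] by (simp add: enc_box_def)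
qed

lemma ecf_code_unique:
  assumes f: "ecf_code g n f" and f': "ecf_code g n f'" and len: "length xs = n"
  shows "f xs = f' xs"
proof (rule ccontr)
  assume ne: "f xs \<noteq> f' xs"
  obtain G where G: "\<And>B. is_box n B \<Longrightarrow> tm_computes g (enc_box B) (enc_interval (G B))"
    "\<And>B xs. is_box n B \<Longrightarrow> in_box xs B \<Longrightarrow>
       f xs \<in> {of_rat (fst (G B)) <..< of_rat (snd (G B))}"
    "\<And>M \<epsilon>. (M::real) > 0 \<Longrightarrow> (\<epsilon>::real) > 0 \<Longrightarrow> \<exists>\<delta> > (0::real). \<forall>B.
           is_box n B \<and>
           (\<forall>(a, b) \<in> set B. {of_rat a <..< of_rat b} \<subseteq> {-M..M}
                             \<and> \<bar>of_rat a - of_rat b\<bar> < \<delta>) \<longrightarrow>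
           \<bar>of_rat (fst (G B)) - of_rat (snd (G B))\<bar> < \<epsilon>"
    using f unfolding ecf_code_def by blast
  obtain G' where G': "\<And>B. is_box n B \<Longrightarrow> tm_computes g (enc_box B) (enc_interval (G' B))"
    "\<And>B xs. is_box n B \<Longrightarrow> in_box xs B \<Longrightarrow>
       f' xs \<in> {of_rat (fst (G' B)) <..< of_rat (snd (G' B))}"
    using f' unfolding ecf_code_def by blast
  have eq: "G B = G' B" if "is_box n B" for B
    using G(1)[OF that] G'(1)[OF that] tm_computes_unique inj_enc_interval by (metis injD)
  define M where "M = 1 + Max (insert 0 ((\<lambda>x. \<bar>x\<bar>) ` set xs))"
  have M: "\<bar>x\<bar> + 1 \<le> M" if "x \<in> set xs" for x
    unfolding M_def using that by simp
  have "0 \<le> Max (insert 0 ((\<lambda>x. \<bar>x\<bar>) ` set xs))" by (rule Max_ge) auto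
  then have "M > 0" unfolding M_def by linarith
  moreover have "\<bar>f xs - f' xs\<bar> > 0" using ne by simp
  ultimately obtain \<delta> :: real where \<delta>: "\<delta> > 0" "\<And>B.
           is_box n B \<and>
           (\<forall>(a, b) \<in> set B. {of_rat a <..< of_rat b} \<subseteq> {-M..M}
                             \<and> \<bar>of_rat a - of_rat b\<bar> < \<delta>) \<Longrightarrow>
           \<bar>of_rat (fst (G B)) - of_rat (snd (G B))\<bar> < \<bar>f xs - f' xs\<bar>"
    using G(3) by meson
  define \<eta> where "\<eta> = min 1 (\<delta> / 2)"
  have \<eta>: "\<eta> > 0" "\<eta> \<le> 1" "2 * \<eta> \<le> \<delta>" using \<delta>(1) by (auto simp: \<eta>_def)
  define lo where "lo x = (SOME q. x - \<eta> < of_rat q \<and> of_rat q < x)" for x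
  define hi where "hi x = (SOME q. x < of_rat q \<and> of_rat q < x + \<eta>)" for x
  have lo: "x - \<eta> < of_rat (lo x) \<and> of_rat (lo x) < x" for x
    unfolding lo_def by (rule someI_ex) (use \<eta>(1) of_rat_dense[of "x - \<eta>" x] in auto)
  have hi: "x < of_rat (hi x) \<and> of_rat (hi x) < x + \<eta>" for x
    unfolding hi_def by (rule someI_ex) (use \<eta>(1) of_rat_dense[of x "x + \<eta>"] in auto)
  define B where "B = map (\<lambda>x. (lo x, hi x)) xs"
  have lh: "lo x < hi x" for x
    using lo[of x] hi[of x] by (metis less_trans of_rat_less)
  have box: "is_box n B" using len lh by (auto simp: is_box_def B_def)
  have inb: "in_box xs B"
    using lo hi by (auto simp: in_box_def B_def list_all2_conv_all_nth)
  have "{of_rat (lo x) <..< of_rat (hi x)} \<subseteq> {-M..M} \<and> \<bar>of_rat (lo x) - of_rat (hi x)\<bar> < \<delta>"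
    if "x \<in> set xs" for x
    using lo[of x] hi[of x] \<eta> M[OF that] by auto
  then have "\<bar>of_rat (fst (G B)) - of_rat (snd (G B))\<bar> < \<bar>f xs - f' xs\<bar>"
    using box by (intro \<delta>(2)) (auto simp: B_def)
  then show False
    using G(2)[OF box inb] G'(2)[OF box inb] eq[OF box] by auto
qed

end

theory Submission
  imports Defs "HOL-Number_Theory.Cong" "HOL-Library.Nat_Bijection"
begin

text \<open>A sentence is true iff there is a bound m such that for every precision k the sentence holds
  approximately: existential quantifiers range over rational intervals inside (-m, m) of length
  below 1/(k+1), terms are evaluated in interval arithmetic with the codes applied to boxes,
  s = t means that the two intervals overlap, and s < t is weakened to the possibility of
  s + 1/(m+1) < t.  A true sentence satisfies this for large m, since witnesses have rational
  intervals around them; conversely a sequence of approximations of increasing precision has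
  convergent witnesses by Bolzano-Weierstrass, and the closed conditions pass to the limit.
  Approximate truth is recursively enumerable in m, k and the sentence, so the criterion has the
  form of a Sigma-3 definition.  Recursive enumerability is handled by closure properties of the sets
  definable by positive existential formulas, where the beta function yields reflexive transitive
  closures, and these yield all the recursions needed.\<close>

section \<open>Sets definable by positive existential formulas\<close>

text \<open>Two things are lost in a limit: the strictness of inequalities and, without a bound, the
  witnesses themselves. One outermost number \<open>m\<close> pays for both: it confines the
  witnesses to a compact set, and its reciprocal separates the two sides of every strict inequality.
  Both demands weaken as \<open>m\<close> grows, so one large \<open>m\<close> serves a whole
  sentence. The intervals that a code returns need not be nested, and approximations of different
  precision may use unrelated witnesses; hence the passage from all \<open>k\<close> to truth goes
  through subsequences and not through monotonicity in \<open>k\<close>. A limit of witnesses may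
  also lie outside the intervals that approximate it, so both defining properties of a code are
  combined to control its outputs near a point (\<open>ecf_code_near\<close>). Whether a function
  symbol is a code is undecidable. The formula does not express it: the reduction yields well-formed
  sentences, and on these the formula only has to run machines on boxes.\<close>

text \<open>Formulas with unbounded existential quantifiers in arbitrary positive positions.  They are
  closed under all the operations needed below, and bounding all their existential quantifiers by
  one fresh variable brings them into prenex form.\<close>

primrec pos_form :: "arith_form \<Rightarrow> bool" where
  "pos_form (ALess s t) \<longleftrightarrow> True"
| "pos_form (AEqual s t) \<longleftrightarrow> True"
| "pos_form (ANeg \<phi>) \<longleftrightarrow> False"
| "pos_form (AConj \<phi> \<psi>) \<longleftrightarrow> pos_form \<phi> \<and> pos_form \<psi>"
| "pos_form (ADisj \<phi> \<psi>) \<longleftrightarrow> pos_form \<phi> \<and> pos_form \<psi>"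
| "pos_form (ABall x t \<phi>) \<longleftrightarrow> pos_form \<phi>"
| "pos_form (ABex x t \<phi>) \<longleftrightarrow> pos_form \<phi>"
| "pos_form (AAll x \<phi>) \<longleftrightarrow> False"
| "pos_form (AEx x \<phi>) \<longleftrightarrow> pos_form \<phi>"

primrec relativize :: "nat \<Rightarrow> arith_form \<Rightarrow> arith_form" where
  "relativize z (ALess s t) = ALess s t"
| "relativize z (AEqual s t) = AEqual s t"
| "relativize z (ANeg \<phi>) = ANeg \<phi>"
| "relativize z (AConj \<phi> \<psi>) = AConj (relativize z \<phi>) (relativize z \<psi>)"
| "relativize z (ADisj \<phi> \<psi>) = ADisj (relativize z \<phi>) (relativize z \<psi>)"
| "relativize z (ABall x t \<phi>) = ABall x t (relativize z \<phi>)"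
| "relativize z (ABex x t \<phi>) = ABex x t (relativize z \<phi>)"
| "relativize z (AAll x \<phi>) = AAll x \<phi>"
| "relativize z (AEx x \<phi>) = ABex x (AVar z) (relativize z \<phi>)"

primrec arith_vars :: "arith_term \<Rightarrow> nat set" where
  "arith_vars (AVar x) = {x}"
| "arith_vars AZero = {}"
| "arith_vars (ASuc t) = arith_vars t"
| "arith_vars (AAdd s t) = arith_vars s \<union> arith_vars t"
| "arith_vars (AMul s t) = arith_vars s \<union> arith_vars t"

primrec form_vars :: "arith_form \<Rightarrow> nat set" where
  "form_vars (ALess s t) = arith_vars s \<union> arith_vars t"
| "form_vars (AEqual s t) = arith_vars s \<union> arith_vars t"
| "form_vars (ANeg \<phi>) = form_vars \<phi>"
| "form_vars (AConj \<phi> \<psi>) = form_vars \<phi> \<union> form_vars \<psi>"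
| "form_vars (ADisj \<phi> \<psi>) = form_vars \<phi> \<union> form_vars \<psi>"
| "form_vars (ABall x t \<phi>) = insert x (arith_vars t \<union> form_vars \<phi>)"
| "form_vars (ABex x t \<phi>) = insert x (arith_vars t \<union> form_vars \<phi>)"
| "form_vars (AAll x \<phi>) = insert x (form_vars \<phi>)"
| "form_vars (AEx x \<phi>) = insert x (form_vars \<phi>)"

lemma finite_arith_vars [simp]: "finite (arith_vars t)"
  by (induction t) auto

lemma finite_form_vars [simp]: "finite (form_vars \<phi>)"
  by (induction \<phi>) auto

lemma arith_val_fresh: "z \<notin> arith_vars t \<Longrightarrow> arith_val (e(z := v)) t = arith_val e t"
  by (induction t) auto

lemma bounded_relativize: "pos_form \<phi> \<Longrightarrow> bounded_form (relativize z \<phi>)"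
  by (induction \<phi>) auto

text \<open>The variable \<open>z\<close> is introduced only as an upper bound of existential
  quantifiers, none of them below a negation, so a larger value keeps every witness
  admissible.\<close>

lemma relativize_mono:
  assumes "pos_form \<phi>" "z \<notin> form_vars \<phi>" "m \<le> n" "arith_holds (e(z := m)) (relativize z \<phi>)"
  shows "arith_holds (e(z := n)) (relativize z \<phi>)"
  using assms
proof (induction \<phi> arbitrary: e)
  case (ABall x t \<phi>)
  then show ?case by (auto simp: arith_val_fresh fun_upd_twist simp del: fun_upd_apply)
next
  case (ABex x t \<phi>)
  then show ?case by (auto simp: arith_val_fresh fun_upd_twist simp del: fun_upd_apply)
next
  case (AEx x \<phi>)
  then obtain v where v: "v < m" "arith_holds (e(z := m, x := v)) (relativize z \<phi>)"
    by (auto simp del: fun_upd_apply simp: fun_upd_same)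
  with AEx have "arith_holds (e(x := v, z := n)) (relativize z \<phi>)"
    by (intro AEx.IH) (auto simp: fun_upd_twist simp del: fun_upd_apply)
  with v AEx.prems show ?case by (auto simp: fun_upd_twist fun_upd_same simp del: fun_upd_apply intro!: exI[of _ v])
qed (auto simp: arith_val_fresh)

text \<open>The collection principle: monotone bounds can be merged over finitely many
  \<open>v\<close>. This moves the common bound in front of a bounded universal quantifier.\<close>

lemma ex_common_bound:
  fixes P :: "nat \<Rightarrow> nat \<Rightarrow> bool"
  assumes "\<And>v. v < b \<Longrightarrow> \<exists>m. P v m" "\<And>v m n. P v m \<Longrightarrow> m \<le> n \<Longrightarrow> P v n"
  shows "\<exists>m. \<forall>v<b. P v m"
  using assms(1)
proof (induction b)
  case (Suc b)
  then obtain m m' where "\<forall>v<b. P v m" "P b m'" by (metis less_Suc_eq)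
  then have "\<forall>v<Suc b. P v (max m m')"
    by (metis assms(2) less_Suc_eq max.cobounded1 max.cobounded2)
  then show ?case by blast
qed auto

lemma relativize_iff:
  assumes "pos_form \<phi>" "z \<notin> form_vars \<phi>"
  shows "arith_holds e \<phi> \<longleftrightarrow> (\<exists>m. arith_holds (e(z := m)) (relativize z \<phi>))"
  using assms
proof (induction \<phi> arbitrary: e)
  case (AConj \<phi> \<psi>)
  show ?case
  proof
    assume "arith_holds e (AConj \<phi> \<psi>)"
    then obtain m m' where "arith_holds (e(z := m)) (relativize z \<phi>)"
      "arith_holds (e(z := m')) (relativize z \<psi>)"
      using AConj by (auto simp del: fun_upd_apply)
    then have "arith_holds (e(z := max m m')) (relativize z (AConj \<phi> \<psi>))"
      using AConj.prems by (auto simp del: fun_upd_apply intro: relativize_mono max.cobounded1 max.cobounded2)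
    then show "\<exists>m. arith_holds (e(z := m)) (relativize z (AConj \<phi> \<psi>))" ..
  qed (use AConj in \<open>auto simp del: fun_upd_apply\<close>)
next
  case (ABall x t \<phi>)
  have "(\<forall>v<arith_val e t. \<exists>m. arith_holds (e(x := v, z := m)) (relativize z \<phi>)) \<longleftrightarrow>
    (\<exists>m. \<forall>v<arith_val e t. arith_holds (e(x := v, z := m)) (relativize z \<phi>))"
  proof
    assume "\<forall>v<arith_val e t. \<exists>m. arith_holds (e(x := v, z := m)) (relativize z \<phi>)"
    then show "\<exists>m. \<forall>v<arith_val e t. arith_holds (e(x := v, z := m)) (relativize z \<phi>)"
      using ABall.prems by (intro ex_common_bound) (auto simp del: fun_upd_apply intro: relativize_mono)
  qed auto
  then show ?case using ABall by (simp add: arith_val_fresh fun_upd_twist del: fun_upd_apply)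
next
  case (ABex x t \<phi>)
  then show ?case by (auto simp: arith_val_fresh fun_upd_twist simp del: fun_upd_apply)
next
  case (AEx x \<phi>)
  show ?case
  proof
    assume "arith_holds e (AEx x \<phi>)"
    then obtain v m where "arith_holds (e(x := v, z := m)) (relativize z \<phi>)"
      using AEx by (auto simp del: fun_upd_apply)
    \<comment> \<open>The bound is strict, so it has to reach \<open>Suc v\<close> to admit the
      witness \<open>v\<close>, besides keeping the bound \<open>m\<close> of the matrix.\<close>
    then have "arith_holds (e(x := v, z := max m (Suc v))) (relativize z \<phi>)"
      using AEx.prems
      by (auto simp del: fun_upd_apply intro: relativize_mono[OF _ _ max.cobounded1])
    then have "arith_holds (e(z := max m (Suc v))) (relativize z (AEx x \<phi>))"
      using AEx.prems by (auto simp: fun_upd_twist fun_upd_same simp del: fun_upd_apply intro!: exI[of _ v])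
    then show "\<exists>m. arith_holds (e(z := m)) (relativize z (AEx x \<phi>))" ..
  next
    assume "\<exists>m. arith_holds (e(z := m)) (relativize z (AEx x \<phi>))"
    then show "arith_holds e (AEx x \<phi>)"
      using AEx by (auto simp: fun_upd_twist simp del: fun_upd_apply)
  qed
qed (auto simp: arith_val_fresh)

lemma pos_form_sigma_form:
  assumes "pos_form \<phi>"
  obtains \<psi> where "sigma_form 1 \<psi>" "\<And>e. arith_holds e \<psi> \<longleftrightarrow> arith_holds e \<phi>"
proof -
  obtain z where z: "z \<notin> form_vars \<phi>"
    using ex_new_if_finite[OF infinite_UNIV_nat finite_form_vars] by blast
  have "sigma_form (Suc 0) (AEx z (relativize z \<phi>))"
    by (intro sigma_form_pi_form.intros bounded_relativize assms)
  with relativize_iff[OF assms z] show thesis by (intro that[of "AEx z (relativize z \<phi>)"]) auto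
qed

text \<open>The truth value depends on variable 0 alone. A defining formula can therefore be placed
  inside other formulas without renaming bound variables.\<close>

definition re_set :: "nat set \<Rightarrow> bool" where
  "re_set A \<longleftrightarrow> (\<exists>\<phi>. pos_form \<phi> \<and> (\<forall>e. arith_holds e \<phi> \<longleftrightarrow> e 0 \<in> A))"

lemma re_setI: "pos_form \<phi> \<Longrightarrow> (\<And>e. arith_holds e \<phi> \<longleftrightarrow> e 0 \<in> A) \<Longrightarrow> re_set A"
  by (auto simp: re_set_def)

definition set_form :: "nat set \<Rightarrow> arith_form" where
  "set_form A = (SOME \<phi>. pos_form \<phi> \<and> (\<forall>e. arith_holds e \<phi> \<longleftrightarrow> e 0 \<in> A))"

lemma set_form:
  assumes "re_set A"
  shows "pos_form (set_form A)" "arith_holds e (set_form A) \<longleftrightarrow> e 0 \<in> A"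
  using someI_ex[OF assms[unfolded re_set_def]] by (auto simp: set_form_def)

text \<open>Membership of variable k > 0 in A.  Rebinding variable 0 makes substitution in formulas
  unnecessary.\<close>

definition mem :: "nat \<Rightarrow> nat set \<Rightarrow> arith_form" where
  "mem k A = AEx 0 (AConj (AEqual (AVar 0) (AVar k)) (set_form A))"

lemma mem_form:
  assumes "re_set A"
  shows "pos_form (mem k A)" "k \<noteq> 0 \<Longrightarrow> arith_holds e (mem k A) \<longleftrightarrow> e k \<in> A"
  using set_form[OF assms] by (auto simp: mem_def)

text \<open>The Cantor pairing \<open>prod_encode\<close>, with both sides doubled to clear the
  division by 2 in the triangular number.\<close>

definition pair_form :: "arith_term \<Rightarrow> arith_term \<Rightarrow> arith_term \<Rightarrow> arith_form" where
  "pair_form a b c = AEqual (AAdd (AMul (AAdd a b) (ASuc (AAdd a b))) (AAdd a a)) (AAdd c c)"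

lemma pos_form_pair [simp]: "pos_form (pair_form a b c)"
  by (simp add: pair_form_def)

lemma pair_form [simp]:
  "arith_holds e (pair_form a b c) \<longleftrightarrow>
     arith_val e c = prod_encode (arith_val e a, arith_val e b)"
proof -
  have "2 * prod_encode (x, y) = (x + y) * Suc (x + y) + (x + x)" for x y
  proof -
    have "2 dvd (x + y) * Suc (x + y)" by simp
    from dvd_mult_div_cancel[OF this] show ?thesis
      by (simp only: prod_encode_def triangle_def prod.case distrib_left mult_2)
  qed
  from this[of "arith_val e a" "arith_val e b"] show ?thesis
    unfolding pair_form_def arith_holds.simps arith_val.simps by linarith
qed

section \<open>Typed data\<close>

text \<open>The range has to be definable because the graphs of the identity, the projections and
  the constants consist of pairs of codes only.\<close>

class godel =
  fixes godel :: "'a \<Rightarrow> nat"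
  assumes inj_godel: "inj godel"
    and re_range_godel: "re_set (range godel)"

lemma godel_eq_iff [simp]: "godel x = godel y \<longleftrightarrow> x = (y :: 'a :: godel)"
  using inj_godel by (auto dest: injD)

definition re :: "('a :: godel \<Rightarrow> bool) \<Rightarrow> bool" where
  "re P \<longleftrightarrow> re_set (godel ` {x. P x})"

text \<open>A total function is computable iff its graph is recursively enumerable; this replaces a
  separate model of computation.\<close>

definition cf :: "('a :: godel \<Rightarrow> 'b :: godel) \<Rightarrow> bool" where
  "cf f \<longleftrightarrow> re_set {prod_encode (godel x, godel (f x)) |x. True}"

instantiation nat :: godel
begin
definition godel_nat :: "nat \<Rightarrow> nat" where "godel_nat n = n"
instance
  by standard
    (auto simp: godel_nat_def[abs_def] inj_def intro!: re_setI[of "AEqual AZero AZero"])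
end

lemma godel_nat [simp]: "godel (n :: nat) = n"
  by (simp add: godel_nat_def)

instantiation prod :: (godel, godel) godel
begin
definition godel_prod :: "'a \<times> 'b \<Rightarrow> nat" where
  "godel_prod p = prod_encode (godel (fst p), godel (snd p))"
instance
proof
  show "inj (godel :: 'a \<times> 'b \<Rightarrow> nat)"
    by (auto simp: inj_def godel_prod_def)
  show "re_set (range (godel :: 'a \<times> 'b \<Rightarrow> nat))"
    by (rule re_setI[of "AEx 1 (AEx 2 (AConj (pair_form (AVar 1) (AVar 2) (AVar 0))
          (AConj (mem 1 (range (godel :: 'a \<Rightarrow> nat))) (mem 2 (range (godel :: 'b \<Rightarrow> nat))))))"])
      (auto simp: mem_form re_range_godel godel_prod_def image_iff)
qed
end

lemma godel_Pair [simp]: "godel (x, y) = prod_encode (godel x, godel y)"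
  by (simp add: godel_prod_def)

lemma re_conj: "re P \<Longrightarrow> re Q \<Longrightarrow> re (\<lambda>x. P x \<and> Q x)"
  unfolding re_def
  by (rule re_setI[of "AConj (set_form (godel ` {x. P x})) (set_form (godel ` {x. Q x}))"])
    (auto simp: set_form)

lemma re_disj: "re P \<Longrightarrow> re Q \<Longrightarrow> re (\<lambda>x. P x \<or> Q x)"
  unfolding re_def
  by (rule re_setI[of "ADisj (set_form (godel ` {x. P x})) (set_form (godel ` {x. Q x}))"])
    (auto simp: set_form)

lemma re_ex:
  assumes "re (\<lambda>p. P (fst p) (snd p))"
  shows "re (\<lambda>x. \<exists>y. P x y)"
  using assms unfolding re_def
  by (intro re_setI[of "AEx 1 (AEx 2 (AConj (pair_form (AVar 0) (AVar 1) (AVar 2))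
          (mem 2 (godel ` {p. P (fst p) (snd p)}))))"])
     (auto simp: mem_form image_iff)

lemma re_comp:
  assumes "re P" "cf f"
  shows "re (\<lambda>x. P (f x))"
  using assms unfolding re_def cf_def
  by (intro re_setI[of "AEx 1 (AEx 2 (AConj (pair_form (AVar 0) (AVar 1) (AVar 2))
          (AConj (mem 2 {prod_encode (godel x, godel (f x)) |x. True}) (mem 1 (godel ` {x. P x})))))"])
     (auto simp: mem_form image_iff)

lemma cf_comp:
  assumes "cf f" "cf g"
  shows "cf (\<lambda>x. f (g x))"
  using assms unfolding cf_def
  by (intro re_setI[of "AEx 1 (AEx 2 (AEx 3 (AEx 4 (AEx 5 
          (AConj (pair_form (AVar 1) (AVar 3) (AVar 0))
          (AConj (pair_form (AVar 1) (AVar 2) (AVar 4)) 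
          (AConj (pair_form (AVar 2) (AVar 3) (AVar 5)) 
          (AConj (mem 4 {prod_encode (godel x, godel (g x)) |x. True}) 
            (mem 5 {prod_encode (godel x, godel (f x)) |x. True})))))))))"])
     (auto simp: mem_form)

lemma cf_Pair:
  assumes "cf f" "cf g"
  shows "cf (\<lambda>x. (f x, g x))"
  using assms unfolding cf_def
  by (intro re_setI[of "AEx 1 (AEx 2 (AEx 3 (AEx 4 (AEx 5 (AEx 6
          (AConj (pair_form (AVar 1) (AVar 2) (AVar 0))
          (AConj (pair_form (AVar 3) (AVar 4) (AVar 2))
          (AConj (pair_form (AVar 1) (AVar 3) (AVar 5)) 
          (AConj (pair_form (AVar 1) (AVar 4) (AVar 6)) 
          (AConj (mem 5 {prod_encode (godel x, godel (f x)) |x. True}) 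
            (mem 6 {prod_encode (godel x, godel (g x)) |x. True})))))))))))"])
     (auto simp: mem_form)

lemma cf_id: "cf (\<lambda>x :: 'a :: godel. x)"
  using re_range_godel[where 'a = 'a] unfolding cf_def
  by (intro re_setI[of "AEx 1 (AConj (pair_form (AVar 1) (AVar 1) (AVar 0))
          (mem 1 (range (godel :: 'a \<Rightarrow> nat))))"])
     (auto simp: mem_form)

lemma cf_fst_fun: "cf (fst :: 'a :: godel \<times> 'b :: godel \<Rightarrow> 'a)"
  using re_range_godel[where 'a = 'a] re_range_godel[where 'a = 'b] unfolding cf_def
  by (intro re_setI[of "AEx 1 (AEx 2 (AEx 3 
          (AConj (pair_form (AVar 1) (AVar 2) (AVar 3))
          (AConj (pair_form (AVar 3) (AVar 1) (AVar 0))
          (AConj (mem 1 (range (godel :: 'a \<Rightarrow> nat))) (mem 2 (range (godel :: 'b \<Rightarrow> nat))))))))"])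
     (auto simp: mem_form godel_prod_def)

lemma cf_snd_fun: "cf (snd :: 'a :: godel \<times> 'b :: godel \<Rightarrow> 'b)"
  using re_range_godel[where 'a = 'a] re_range_godel[where 'a = 'b] unfolding cf_def
  by (intro re_setI[of "AEx 1 (AEx 2 (AEx 3 
          (AConj (pair_form (AVar 1) (AVar 2) (AVar 3))
          (AConj (pair_form (AVar 3) (AVar 2) (AVar 0))
          (AConj (mem 1 (range (godel :: 'a \<Rightarrow> nat))) (mem 2 (range (godel :: 'b \<Rightarrow> nat))))))))"])
     (auto simp: mem_form godel_prod_def)

lemma cf_const: "cf (\<lambda>x :: 'a :: godel. c :: 'b :: godel)"
proof -
  have num: "arith_val e ((ASuc ^^ n) AZero) = n" for e n
    by (induction n) auto
  show ?thesis
    using re_range_godel[where 'a = 'a] unfolding cf_def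
    by (intro re_setI[of "AEx 1 (AConj (pair_form (AVar 1) ((ASuc ^^ (godel c)) AZero) (AVar 0))
          (mem 1 (range (godel :: 'a \<Rightarrow> nat))))"])
       (auto simp: mem_form num)
qed

lemma cf_fst: "cf f \<Longrightarrow> cf (\<lambda>x. fst (f x))"
  and cf_snd: "cf f \<Longrightarrow> cf (\<lambda>x. snd (f x))"
  by (rule cf_comp[OF cf_fst_fun], assumption) (rule cf_comp[OF cf_snd_fun], assumption)

lemma cf_iff_graph: "cf f \<longleftrightarrow> re (\<lambda>p. snd p = f (fst p))"
proof -
  have "{prod_encode (godel x, godel (f x)) |x. True} = godel ` {p. snd p = f (fst p)}"
    by (force simp: image_iff)
  then show ?thesis by (simp add: cf_def re_def)
qed

lemma re_eq:
  fixes f g :: "'a :: godel \<Rightarrow> 'b :: godel"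
  assumes "cf f" "cf g"
  shows "re (\<lambda>x. f x = g x)"
proof -
  have "re (\<lambda>p :: 'b \<times> 'b. snd p = fst p)" using cf_id by (simp add: cf_iff_graph)
  from re_comp[OF this cf_Pair[OF assms(2) assms(1)]] show ?thesis by simp
qed

lemma re_less:
  fixes f g :: "'a :: godel \<Rightarrow> nat"
  assumes "cf f" "cf g"
  shows "re (\<lambda>x. f x < g x)"
proof -
  have "re (\<lambda>p :: nat \<times> nat. fst p < snd p)"
    unfolding re_def
    by (intro re_setI[of "AEx 1 (AEx 2 (AConj (pair_form (AVar 1) (AVar 2) (AVar 0))
          (ALess (AVar 1) (AVar 2))))"]) (auto simp: image_iff)
  from re_comp[OF this cf_Pair[OF assms]] show ?thesis by simp
qed

lemma cf_plus_nat:
  fixes f g :: "'a :: godel \<Rightarrow> nat"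
  assumes "cf f" "cf g"
  shows "cf (\<lambda>x. f x + g x)"
proof -
  have "cf (\<lambda>p :: nat \<times> nat. fst p + snd p)"
    unfolding cf_def
    by (intro re_setI[of "AEx 1 (AEx 2 (AEx 3 (AConj (pair_form (AVar 1) (AVar 2) (AVar 3))
          (pair_form (AVar 3) (AAdd (AVar 1) (AVar 2)) (AVar 0)))))"]) auto
  from cf_comp[OF this cf_Pair[OF assms]] show ?thesis by simp
qed

lemma cf_times_nat:
  fixes f g :: "'a :: godel \<Rightarrow> nat"
  assumes "cf f" "cf g"
  shows "cf (\<lambda>x. f x * g x)"
proof -
  have "cf (\<lambda>p :: nat \<times> nat. fst p * snd p)"
    unfolding cf_def
    by (intro re_setI[of "AEx 1 (AEx 2 (AEx 3 (AConj (pair_form (AVar 1) (AVar 2) (AVar 3))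
          (pair_form (AVar 3) (AMul (AVar 1) (AVar 2)) (AVar 0)))))"]) auto
  from cf_comp[OF this cf_Pair[OF assms]] show ?thesis by simp
qed

text \<open>On codes this is the identity, because a number codes itself. It makes codes accessible
  to the closure rules, and so also constructors that are defined by arithmetic on codes.\<close>

lemma cf_godel: "cf (godel :: 'a :: godel \<Rightarrow> nat)"
  using re_range_godel[where 'a = 'a] unfolding cf_def
  by (intro re_setI[of "AEx 1 (AConj (pair_form (AVar 1) (AVar 1) (AVar 0))
          (mem 1 (range (godel :: 'a \<Rightarrow> nat))))"])
     (auto simp: mem_form)

section \<open>Goedel's beta function and transitive closures\<close>

definition beta :: "nat \<Rightarrow> nat \<Rightarrow> nat \<Rightarrow> nat" where
  "beta c d i = c mod Suc (Suc i * d)"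

text \<open>Eliminating \<open>d\<close> from the two moduli leaves \<open>j - i\<close>. A common
  divisor thus divides \<open>j - i\<close> and with it \<open>d\<close>, and then also 1, as each
  modulus exceeds a multiple of \<open>d\<close> by 1.\<close>

lemma coprime_beta_moduli:
  assumes "i < j" "j - i dvd d"
  shows "coprime (Suc (Suc i * d)) (Suc (Suc j * d))"
proof (rule coprimeI)
  fix c assume c: "c dvd Suc (Suc i * d)" "c dvd Suc (Suc j * d)"
  have "Suc j * Suc (Suc i * d) - Suc i * Suc (Suc j * d) = j - i"
    using assms(1) by (simp add: algebra_simps)
  then have "c dvd j - i" using c by (metis dvd_diff_nat dvd_mult)
  then have "c dvd Suc i * d" using assms(2) by (meson dvd_mult dvd_trans)
  then show "is_unit c" using c(1) by (metis dvd_add_right_iff plus_1_eq_Suc add.commute)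
qed

lemma beta_exists: "\<exists>c d. \<forall>i\<le>n. beta c d i = a i"
proof -
  \<comment> \<open>\<open>m\<close> exceeds all values and all indices. Its factorial is then
    divisible by every difference of indices, which makes the moduli coprime, and large enough for
    every value to be its own remainder.\<close>
  define m where "m = Suc (Max (insert n (a ` {..n})))"
  have m: "a i < m" "n < m" if "i \<le> n" for i
    unfolding m_def less_Suc_eq_le by (rule Max_ge; use that in auto)+
  define d where "d = (fact m :: nat)"
  have "m \<le> d" unfolding d_def by (rule fact_ge_self)
  have "coprime (Suc (Suc i * d)) (Suc (Suc j * d))" if "i < j" "j \<le> n" for i j
    using that m(2)[of j] by (intro coprime_beta_moduli) (auto simp: d_def intro!: dvd_fact)
  then have "\<forall>i\<in>{..n}. \<forall>j\<in>{..n}. i \<noteq> j \<longrightarrow> coprime (Suc (Suc i * d)) (Suc (Suc j * d))"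
    by (metis atMost_iff coprime_commute linorder_neqE_nat)
  from chinese_remainder_nat[OF _ this, of a]
  obtain c where c: "\<And>i. i \<le> n \<Longrightarrow> [c = a i] (mod Suc (Suc i * d))" by auto
  have "beta c d i = a i" if "i \<le> n" for i
  proof -
    have "a i < Suc (Suc i * d)" using m(1)[OF that] \<open>m \<le> d\<close> by simp
    then show ?thesis using c[OF that] by (simp add: beta_def cong_def)
  qed
  then show ?thesis by blast
qed

text \<open>The value is a remainder, and variable 20 is the quotient; its number lies above all
  variables in the argument terms used.\<close>

definition beta_form :: "arith_term \<Rightarrow> arith_term \<Rightarrow> arith_term \<Rightarrow> arith_term \<Rightarrow> arith_form" where
  "beta_form c d i u = AEx 20 (AConj (ALess u (ASuc (AMul (ASuc i) d)))
     (AEqual c (AAdd (AMul (AVar 20) (ASuc (AMul (ASuc i) d))) u)))"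

lemma pos_form_beta [simp]: "pos_form (beta_form c d i u)"
  by (simp add: beta_form_def)

lemma beta_form:
  assumes "20 \<notin> arith_vars c \<union> arith_vars d \<union> arith_vars i \<union> arith_vars u"
  shows "arith_holds e (beta_form c d i u) \<longleftrightarrow>
    arith_val e u = beta (arith_val e c) (arith_val e d) (arith_val e i)"
proof -
  have "u < m \<and> (\<exists>q. c = q * m + u) \<longleftrightarrow> u = c mod m" if "m > 0" for u m c :: nat
    using that by (metis div_mult_mod_eq mod_less mod_less_divisor mod_mult_self3)
  from this[of "Suc (Suc (arith_val e i) * arith_val e d)"] show ?thesis
    using assms by (simp add: beta_form_def beta_def arith_val_fresh del: mult_Suc)
qed

lemma rtranclp_beta:
  fixes R :: "nat \<Rightarrow> nat \<Rightarrow> bool"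
  shows "R\<^sup>*\<^sup>* x y \<longleftrightarrow>
    (\<exists>c d n. x = beta c d 0 \<and> y = beta c d n \<and> (\<forall>i<n. R (beta c d i) (beta c d (Suc i))))"
proof
  assume "R\<^sup>*\<^sup>* x y"
  then obtain n f where f: "f 0 = x" "f n = y" "\<forall>i<n. R (f i) (f (Suc i))"
    by (auto simp: rtranclp_power relpowp_fun_conv)
  obtain c d where "\<forall>i\<le>n. beta c d i = f i" using beta_exists by blast
  with f show "\<exists>c d n. x = beta c d 0 \<and> y = beta c d n \<and> (\<forall>i<n. R (beta c d i) (beta c d (Suc i)))"
    by (intro exI[of _ c] exI[of _ d] exI[of _ n]) auto
qed (auto simp: rtranclp_power relpowp_fun_conv)

text \<open>The set \<open>B\<close> is there for the reflexive case: the closure relates every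
  number to itself, also numbers that code nothing. When \<open>B\<close> is the range of
  \<open>godel\<close> and \<open>A\<close> consists of pairs of codes, a path that starts in
  \<open>B\<close> stays there.\<close>

lemma re_set_rtranclp:
  assumes A: "re_set A" and B: "re_set B"
  shows "re_set {prod_encode (x, y) |x y. x \<in> B \<and> (\<lambda>u v. prod_encode (u, v) \<in> A)\<^sup>*\<^sup>* x y}"
  unfolding rtranclp_beta
  by (rule re_setI[of "AEx 1 (AEx 2 (AEx 3 (AEx 4 (AEx 5
     (AConj (pair_form (AVar 1) (AVar 2) (AVar 0))
     (AConj (mem 1 B)
     (AConj (beta_form (AVar 3) (AVar 4) AZero (AVar 1))
     (AConj (beta_form (AVar 3) (AVar 4) (AVar 5) (AVar 2))
     (ABall 6 (AVar 5) (AEx 7 (AEx 8 (AEx 9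
       (AConj (beta_form (AVar 3) (AVar 4) (AVar 6) (AVar 7))
       (AConj (beta_form (AVar 3) (AVar 4) (ASuc (AVar 6)) (AVar 8))
       (AConj (pair_form (AVar 7) (AVar 8) (AVar 9))
         (mem 9 A))))))))))))))))"])
    (simp_all add: mem_form A B beta_form)

lemma re_rtranclp_aux:
  fixes R :: "'a :: godel \<Rightarrow> 'a \<Rightarrow> bool"
  assumes "re (\<lambda>p. R (fst p) (snd p))"
  shows "re (\<lambda>p. R\<^sup>*\<^sup>* (fst p) (snd p))"
proof -
  let ?A = "godel ` {p. R (fst p) (snd p)}"
  let ?S = "\<lambda>u v. prod_encode (u, v) \<in> ?A"
  have S: "?S (godel x) v \<longleftrightarrow> (\<exists>y. v = godel y \<and> R x y)" for x v
    by (auto simp: image_iff)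
  have 1: "\<exists>y. v = godel y \<and> R\<^sup>*\<^sup>* x y" if "?S\<^sup>*\<^sup>* (godel x) v" for x v
    using that
  proof (induction)
    case (step v w)
    then obtain y where y: "v = godel y" "R\<^sup>*\<^sup>* x y" by blast
    with step(2) S obtain z where "w = godel z" "R y z" by blast
    with y show ?case by (blast intro: rtranclp.rtrancl_into_rtrancl)
  qed auto
  have 2: "?S\<^sup>*\<^sup>* (godel x) (godel y)" if "R\<^sup>*\<^sup>* x y" for x y
    using that
  proof (induction)
    case (step y z)
    then have "?S (godel y) (godel z)" using S by blast
    with step.IH show ?case by (rule rtranclp.rtrancl_into_rtrancl)
  qed auto
  have "{prod_encode (x, y) |x y. x \<in> range (godel :: 'a \<Rightarrow> nat) \<and> ?S\<^sup>*\<^sup>* x y}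
    = godel ` {p. R\<^sup>*\<^sup>* (fst p) (snd p)}"
    (is "?L = ?R")
  proof (intro equalityI subsetI)
    fix n assume "n \<in> ?L"
    then obtain x v where n: "n = prod_encode (godel x, v)" "?S\<^sup>*\<^sup>* (godel (x :: 'a)) v" by blast
    with 1 obtain y where "v = godel y" "R\<^sup>*\<^sup>* x y" by blast
    with n show "n \<in> ?R" by (intro image_eqI[of _ _ "(x, y)"]) auto
  next
    fix n assume "n \<in> ?R"
    with 2 show "n \<in> ?L" by force
  qed
  with re_set_rtranclp[OF assms[unfolded re_def] re_range_godel[where 'a = 'a]]
  show ?thesis unfolding re_def by simp
qed

text \<open>The closure rules. A predicate in context \<open>c\<close> that binds further variables
  is treated as a predicate of nested pairs \<open>(c, x)\<close> or \<open>(c, x, y)\<close>; facts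
  about the context alone are moved under such a binder with \<open>cf_comp\<close> or
  \<open>re_comp\<close>. Proofs of enumerability then follow the syntax of a definition.\<close>

named_theorems comp

text \<open>The parameter \<open>c\<close> travels unchanged in the states, which reduces a family
  of relations to a single one.\<close>

lemma re_rtranclp [comp]:
  assumes "re (\<lambda>q. R (fst q) (fst (snd q)) (snd (snd q)))" "cf f" "cf g"
  shows "re (\<lambda>c. (R c)\<^sup>*\<^sup>* (f c) (g c))"
proof -
  let ?S = "\<lambda>p q. fst p = fst q \<and> R (fst p) (snd p) (snd q)"
  have "re (\<lambda>q. ?S (fst q) (snd q))"
    by (intro re_conj re_eq cf_fst cf_snd cf_id
        re_comp[OF assms(1), of "\<lambda>q. (fst (fst q), snd (fst q), snd (snd q))", simplified] cf_Pair)
  then have "re (\<lambda>q. ?S\<^sup>*\<^sup>* (fst q) (snd q))" by (rule re_rtranclp_aux)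
  then have "re (\<lambda>c. ?S\<^sup>*\<^sup>* (c, f c) (c, g c))"
    using re_comp[OF _ cf_Pair[OF cf_Pair[OF cf_id assms(2)] cf_Pair[OF cf_id assms(3)]]] by force
  moreover have "?S\<^sup>*\<^sup>* (c, x) (c, y) \<longleftrightarrow> (R c)\<^sup>*\<^sup>* x y" for c x y
  proof
    show "(R c)\<^sup>*\<^sup>* x y \<Longrightarrow> ?S\<^sup>*\<^sup>* (c, x) (c, y)"
      by (induction rule: rtranclp_induct) (auto elim!: rtranclp.rtrancl_into_rtrancl)
    have "?S\<^sup>*\<^sup>* p q \<Longrightarrow> fst p = fst q \<and> (R (fst p))\<^sup>*\<^sup>* (snd p) (snd q)" for p q
      by (induction rule: rtranclp_induct) (auto elim!: rtranclp.rtrancl_into_rtrancl)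
    from this[of "(c, x)" "(c, y)"] show "?S\<^sup>*\<^sup>* (c, x) (c, y) \<Longrightarrow> (R c)\<^sup>*\<^sup>* x y" by simp
  qed
  ultimately show ?thesis by simp
qed

lemmas [comp] = re_conj re_disj re_ex re_eq re_less cf_Pair cf_id cf_const cf_fst cf_snd
  cf_plus_nat cf_times_nat

lemma cf_graphI: "re (\<lambda>p. snd p = f (fst p)) \<Longrightarrow> cf f"
  by (simp add: cf_iff_graph)

lemma cf_godel' [comp]: "cf f \<Longrightarrow> cf (\<lambda>x. godel (f x))"
  by (rule cf_comp[OF cf_godel])

lemma cf_Suc [comp]: "cf f \<Longrightarrow> cf (\<lambda>x. Suc (f x))"
  using cf_plus_nat[OF _ cf_const[of 1]] by simp

lemma cf_prod_encode [comp]: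
  assumes "cf f" shows "cf (\<lambda>x. prod_encode (f x))"
proof -
  have "godel p = prod_encode p" for p :: "nat \<times> nat" by (cases p) simp
  with cf_godel'[OF assms] show ?thesis by simp
qed

lemma re_nat_range: "re (\<lambda>n. n \<in> range (godel :: 'a :: godel \<Rightarrow> nat))"
  by (simp add: re_def re_range_godel godel_nat_def[abs_def])

lemma re_in_range [comp]: "cf f \<Longrightarrow> re (\<lambda>x. f x \<in> range (godel :: 'a :: godel \<Rightarrow> nat))"
  by (rule re_comp[OF re_nat_range])

lemma re_nat_setD: "re (\<lambda>n. n \<in> A) \<Longrightarrow> re_set A"
  by (simp add: re_def godel_nat_def[abs_def])

section \<open>Booleans, options, lists and list recursion\<close>

instantiation bool :: godel
begin
definition godel_bool :: "bool \<Rightarrow> nat" where "godel_bool b = (if b then 1 else 0)"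
instance
proof
  show "inj (godel :: bool \<Rightarrow> nat)" by (auto simp: inj_def godel_bool_def)
  have "range (godel :: bool \<Rightarrow> nat) = {n. n = 0 \<or> n = 1}"
    by (auto simp: godel_bool_def image_iff split: if_splits)
  moreover have "re (\<lambda>n :: nat. n = 0 \<or> n = 1)" by (intro comp)
  ultimately show "re_set (range (godel :: bool \<Rightarrow> nat))"
    by (intro re_nat_setD) simp
qed
end

instantiation option :: (godel) godel
begin
primrec godel_option :: "'a option \<Rightarrow> nat" where
  "godel_option None = 0"
| "godel_option (Some x) = Suc (godel x)"
instance
proof
  show "inj (godel :: 'a option \<Rightarrow> nat)"
  proof (rule injI)
    fix x y :: "'a option" assume "godel x = godel y"
    then show "x = y" by (cases x; cases y) auto
  qed
  have "range (godel :: 'a option \<Rightarrow> nat)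
    = {n. n = 0 \<or> (\<exists>m. n = Suc m \<and> m \<in> range (godel :: 'a \<Rightarrow> nat))}" (is "?A = ?B")
  proof (intro equalityI subsetI)
    fix n assume "n \<in> ?B"
    then consider "n = godel (None :: 'a option)" | x :: 'a where "n = godel (Some x)" by auto
    then show "n \<in> ?A" by cases (metis rangeI)+
  next
    fix n assume "n \<in> ?A"
    then obtain x :: "'a option" where "n = godel x" by auto
    then show "n \<in> ?B" by (cases x) auto
  qed
  moreover have "re (\<lambda>n. n = 0 \<or> (\<exists>m. n = Suc m \<and> m \<in> range (godel :: 'a \<Rightarrow> nat)))"
    by (intro comp)
  ultimately show "re_set (range (godel :: 'a option \<Rightarrow> nat))"
    by (intro re_nat_setD) simp
qed
end

instantiation list :: (godel) godel
begin
primrec godel_list :: "'a list \<Rightarrow> nat" where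
  "godel_list [] = 0"
| "godel_list (x # xs) = Suc (prod_encode (godel x, godel_list xs))"
instance
proof
  show "inj (godel :: 'a list \<Rightarrow> nat)"
  proof (rule injI)
    fix xs ys :: "'a list" assume "godel xs = godel ys"
    then show "xs = ys"
    proof (induction xs arbitrary: ys)
      case Nil
      then show ?case by (cases ys) auto
    next
      case (Cons x xs)
      then show ?case by (cases ys) auto
    qed
  qed
  \<comment> \<open>\<open>?R\<close> removes the first entry from a list code. The list codes are
    the numbers from which it leads to 0, the code of \<open>[]\<close>.\<close>
  let ?R = "\<lambda>m n. \<exists>k. k \<in> range (godel :: 'a \<Rightarrow> nat) \<and> m = Suc (prod_encode (k, n))"
  have 1: "?R\<^sup>*\<^sup>* (godel xs) 0" for xs :: "'a list"
    by (induction xs) (auto intro: converse_rtranclp_into_rtranclp)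
  have 2: "\<exists>xs :: 'a list. n = godel xs" if "?R\<^sup>*\<^sup>* n 0" for n
    using that
  proof (induction rule: converse_rtranclp_induct)
    case base
    show ?case by (intro exI[of _ "[]"]) simp
  next
    case (step m n)
    then obtain x :: 'a and xs :: "'a list" where "m = godel (x # xs)" by auto
    then show ?case ..
  qed
  have "range (godel :: 'a list \<Rightarrow> nat) = {n. ?R\<^sup>*\<^sup>* n 0}"
    using 1 2 by blast
  moreover have "re (\<lambda>n. ?R\<^sup>*\<^sup>* n 0)"
    by (intro comp)
  ultimately show "re_set (range (godel :: 'a list \<Rightarrow> nat))"
    by (intro re_nat_setD) simp
qed
end

lemma cf_comp3:
  assumes "cf (\<lambda>q. F (fst q) (fst (snd q)) (snd (snd q)))" "cf f" "cf g" "cf h"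
  shows "cf (\<lambda>x. F (f x) (g x) (h x))"
  using cf_comp[OF assms(1) cf_Pair[OF assms(2) cf_Pair[OF assms(3,4)]]] by simp

lemma re_comp3:
  assumes "re (\<lambda>q. P (fst q) (fst (snd q)) (snd (snd q)))" "cf f" "cf g" "cf h"
  shows "re (\<lambda>x. P (f x) (g x) (h x))"
  using re_comp[OF assms(1) cf_Pair[OF assms(2) cf_Pair[OF assms(3,4)]]] by simp

lemma cf_comp2:
  assumes "cf (\<lambda>q. F (fst q) (snd q))" "cf f" "cf g"
  shows "cf (\<lambda>x. F (f x) (g x))"
  using cf_comp[OF assms(1) cf_Pair[OF assms(2,3)]] by simp

lemma re_comp2:
  assumes "re (\<lambda>q. P (fst q) (snd q))" "cf f" "cf g"
  shows "re (\<lambda>x. P (f x) (g x))"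
  using re_comp[OF assms(1) cf_Pair[OF assms(2,3)]] by simp

lemma re_cfI: "cf P \<Longrightarrow> re (\<lambda>x. P x)"
  using re_eq[OF _ cf_const[of True], of P] by simp

text \<open>Post's theorem: for Boolean functions computability is decidability. This is the source
  of the negations below.\<close>

lemma cf_boolI:
  assumes "re P" "re (\<lambda>x. \<not> P x)"
  shows "cf P"
proof (rule cf_graphI)
  have "re (\<lambda>p. snd p = True \<and> P (fst p) \<or> snd p = False \<and> \<not> P (fst p))"
    by (intro comp re_comp[OF assms(1)] re_comp[OF assms(2)])
  moreover have "snd p = P (fst p) \<longleftrightarrow> snd p = True \<and> P (fst p) \<or> snd p = False \<and> \<not> P (fst p)" for p
    by auto
  ultimately show "re (\<lambda>p. snd p = P (fst p))" by simp
qed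

lemma re_not_cf: "cf P \<Longrightarrow> re (\<lambda>x. \<not> P x)"
  using re_eq[OF _ cf_const[of False], of P] by simp

lemma cf_bool_iff: "cf P \<longleftrightarrow> re P \<and> re (\<lambda>x. \<not> P x)"
  by (blast intro: cf_boolI dest: re_cfI re_not_cf)

lemma cf_disj [comp]: "cf P \<Longrightarrow> cf Q \<Longrightarrow> cf (\<lambda>x. P x \<or> Q x)"
  unfolding cf_bool_iff de_Morgan_disj using re_conj re_disj by blast

lemma cf_less_nat [comp]:
  fixes f g :: "'a :: godel \<Rightarrow> nat"
  assumes "cf f" "cf g"
  shows "cf (\<lambda>x. f x < g x)"
proof (rule cf_boolI)
  have "re (\<lambda>x. f x = g x \<or> g x < f x)" by (intro comp assms)
  then show "re (\<lambda>x. \<not> f x < g x)" by (simp add: not_less le_less eq_commute disj_commute)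
qed (intro comp assms)

lemma cf_eq [comp]:
  fixes f g :: "'a :: godel \<Rightarrow> 'b :: godel"
  assumes "cf f" "cf g"
  shows "cf (\<lambda>x. f x = g x)"
proof (rule cf_boolI)
  \<comment> \<open>Distinct codes are comparable as numbers, so being different is enumerable for
    every type.\<close>
  have "re (\<lambda>x. godel (f x) < godel (g x) \<or> godel (g x) < godel (f x))" by (intro comp assms)
  moreover have "godel (f x) < godel (g x) \<or> godel (g x) < godel (f x) \<longleftrightarrow> f x \<noteq> g x" for x
    using godel_eq_iff[of "f x" "g x"] by linarith
  ultimately show "re (\<lambda>x. f x \<noteq> g x)" by simp
qed (intro comp assms)

lemma re_neq [comp]: "cf f \<Longrightarrow> cf g \<Longrightarrow> re (\<lambda>x. f x \<noteq> g x)"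
  by (intro re_not_cf comp)

lemma cf_if [comp]:
  assumes "cf b" "cf f" "cf g"
  shows "cf (\<lambda>x. if b x then f x else g x)"
proof (rule cf_graphI)
  have "re (\<lambda>p. b (fst p) = True \<and> snd p = f (fst p) \<or> b (fst p) = False \<and> snd p = g (fst p))"
    by (intro comp cf_comp[OF assms(1)] cf_comp[OF assms(2)] cf_comp[OF assms(3)])
  then show "re (\<lambda>p. snd p = (if b (fst p) then f (fst p) else g (fst p)))"
    by (rule back_subst[of re]) auto
qed

text \<open>The graph of a constructor is an arithmetical equation between codes, and injectivity of
  \<open>godel\<close> turns it back into an equation between values.\<close>

lemma cf_Some [comp]:
  fixes f :: "'a :: godel \<Rightarrow> 'b :: godel"
  assumes "cf f" shows "cf (\<lambda>x. Some (f x))"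
proof (rule cf_graphI)
  have "re (\<lambda>p. godel (snd p :: 'b option) = Suc (godel (f (fst p))))"
    by (intro comp cf_comp[OF assms])
  then show "re (\<lambda>p. snd p = Some (f (fst p)))"
    unfolding godel_option.simps(2)[symmetric] godel_eq_iff .
qed

lemma cf_Cons [comp]:
  fixes f :: "'a :: godel \<Rightarrow> 'b :: godel"
  assumes "cf f" "cf g" shows "cf (\<lambda>x. f x # g x)"
proof (rule cf_graphI)
  have "re (\<lambda>p. godel (snd p :: 'b list) = Suc (prod_encode (godel (f (fst p)), godel (g (fst p)))))"
    by (intro comp cf_comp[OF assms(1)] cf_comp[OF assms(2)])
  then show "re (\<lambda>p. snd p = f (fst p) # g (fst p))"
    unfolding godel_list.simps(2)[symmetric] godel_eq_iff .
qed

lemma cf_case_option [comp]: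
  assumes "cf f" "cf a" "cf (\<lambda>q. F (fst q) (snd q))"
  shows "cf (\<lambda>c. case f c of None \<Rightarrow> a c | Some x \<Rightarrow> F c x)"
proof (rule cf_graphI)
  have "re (\<lambda>p. f (fst p) = None \<and> snd p = a (fst p)
      \<or> (\<exists>x. f (fst p) = Some x \<and> snd p = F (fst p) x))"
    by (intro comp cf_comp[OF assms(1)] cf_comp[OF assms(2)] cf_comp2[OF assms(3)])
  then show "re (\<lambda>p. snd p = (case f (fst p) of None \<Rightarrow> a (fst p) | Some x \<Rightarrow> F (fst p) x))"
    by (rule back_subst[of re]) (auto split: option.splits)
qed

lemma cf_case_list [comp]:
  assumes "cf f" "cf a" "cf (\<lambda>q. F (fst q) (fst (snd q)) (snd (snd q)))"
  shows "cf (\<lambda>c. case f c of [] \<Rightarrow> a c | x # xs \<Rightarrow> F c x xs)"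
proof (rule cf_graphI)
  have "re (\<lambda>p. f (fst p) = [] \<and> snd p = a (fst p)
      \<or> (\<exists>x xs. f (fst p) = x # xs \<and> snd p = F (fst p) x xs))"
    by (intro comp cf_comp[OF assms(1)] cf_comp[OF assms(2)] cf_comp3[OF assms(3)])
  then show "re (\<lambda>p. snd p = (case f (fst p) of [] \<Rightarrow> a (fst p) | x # xs \<Rightarrow> F (fst p) x xs))"
    by (rule back_subst[of re]) (auto simp: fun_eq_iff split: list.splits)
qed

text \<open>A fold is a run of a transition system on pairs of remaining list and accumulator. The
  system is deterministic, so the accumulator reached with the empty list is the value.\<close>

lemma cf_fold [comp]:
  assumes "cf (\<lambda>q. F (fst q) (fst (snd q)) (snd (snd q)))" "cf xs" "cf a"
  shows "cf (\<lambda>c. fold (F c) (xs c) (a c))"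
proof (rule cf_graphI)
  let ?R = "\<lambda>c p q. \<exists>x. fst p = x # fst q \<and> snd q = F c x (snd p)"
  have "re (\<lambda>p. (?R (fst p))\<^sup>*\<^sup>* (xs (fst p), a (fst p)) ([], snd p))"
    by (intro comp cf_comp3[OF assms(1)] cf_comp[OF assms(2)] cf_comp[OF assms(3)])
  moreover have "(?R c)\<^sup>*\<^sup>* (ys, b) ([], d) \<longleftrightarrow> d = fold (F c) ys b" for c ys b d
  proof
    have "(?R c)\<^sup>*\<^sup>* p q \<Longrightarrow> fst q = [] \<Longrightarrow> snd q = fold (F c) (fst p) (snd p)" for p q
      by (induction rule: converse_rtranclp_induct) auto
    from this[of "(ys, b)" "([], d)"] show "(?R c)\<^sup>*\<^sup>* (ys, b) ([], d) \<Longrightarrow> d = fold (F c) ys b"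
      by simp
    have "(?R c)\<^sup>*\<^sup>* (ys, b) ([], fold (F c) ys b)"
    proof (induction ys arbitrary: b)
      case (Cons y ys)
      show ?case
        by (rule converse_rtranclp_into_rtranclp[of _ _ "(ys, F c y b)"]) (use Cons in auto)
    qed simp
    then show "d = fold (F c) ys b \<Longrightarrow> (?R c)\<^sup>*\<^sup>* (ys, b) ([], d)" by simp
  qed
  ultimately show "re (\<lambda>p. snd p = fold (F (fst p)) (xs (fst p)) (a (fst p)))" by simp
qed

lemma cf_rev [comp]: "cf f \<Longrightarrow> cf (\<lambda>x. rev (f x))"
  unfolding rev_conv_fold by (intro comp)

lemma cf_foldr [comp]:
  assumes "cf (\<lambda>q. F (fst q) (fst (snd q)) (snd (snd q)))" "cf xs" "cf a"
  shows "cf (\<lambda>c. foldr (F c) (xs c) (a c))"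
  unfolding foldr_conv_fold by (intro comp assms)

lemma cf_append [comp]:
  assumes "cf f" "cf g" shows "cf (\<lambda>x. f x @ g x)"
proof -
  have "cf (\<lambda>x. foldr (\<lambda>y acc. y # acc) (f x) (g x))" by (intro comp assms)
  moreover have "foldr (\<lambda>y acc. y # acc) ys zs = ys @ zs" for ys zs :: "'b list"
    by (induction ys) auto
  ultimately show ?thesis by simp
qed

lemma cf_map [comp]:
  assumes "cf (\<lambda>q. F (fst q) (snd q))" "cf xs"
  shows "cf (\<lambda>c. map (F c) (xs c))"
proof -
  have "cf (\<lambda>c. foldr (\<lambda>x acc. F c x # acc) (xs c) [])"
    by (intro comp assms cf_comp2[OF assms(1)])
  moreover have "foldr (\<lambda>x acc. F c x # acc) ys [] = map (F c) ys" for c ys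
    by (induction ys) auto
  ultimately show ?thesis by simp
qed

lemma cf_concat [comp]: "cf f \<Longrightarrow> cf (\<lambda>x. concat (f x))"
  unfolding concat_conv_foldr by (intro comp)

lemma cf_takeWhile [comp]:
  assumes "cf (\<lambda>q. P (fst q) (snd q))" "cf xs"
  shows "cf (\<lambda>c. takeWhile (P c) (xs c))"
proof -
  have "cf (\<lambda>c. foldr (\<lambda>x acc. if P c x then x # acc else []) (xs c) [])"
    by (intro comp assms cf_comp2[OF assms(1)])
  moreover have "foldr (\<lambda>x acc. if P c x then x # acc else []) ys [] = takeWhile (P c) ys" for c ys
    by (induction ys) auto
  ultimately show ?thesis by simp
qed

lemma cf_map_of [comp]:
  assumes "cf xs" "cf f" shows "cf (\<lambda>c. map_of (xs c) (f c))"
proof -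
  have "cf (\<lambda>c. foldr (\<lambda>p r. if f c = fst p then Some (snd p) else r) (xs c) None)"
    by (intro comp assms cf_comp[OF assms(2)])
  moreover have "foldr (\<lambda>p r. if k = fst p then Some (snd p) else r) ys None = map_of ys k"
    for k :: 'b and ys :: "('b \<times> 'c) list"
    by (induction ys) auto
  ultimately show ?thesis by simp
qed

lemma re_mem_set [comp]:
  assumes "cf f" "cf xs" shows "re (\<lambda>c. f c \<in> set (xs c))"
  unfolding in_set_conv_decomp by (intro comp cf_comp[OF assms(1)] cf_comp[OF assms(2)])

text \<open>A universal quantifier over a list becomes a closure: the list can be consumed down to
  \<open>[]\<close> iff every entry permits its own removal.\<close>

lemma re_ball_set [comp]:
  assumes "re (\<lambda>q. P (fst q) (snd q))" "cf xs"
  shows "re (\<lambda>c. \<forall>x\<in>set (xs c). P c x)"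
proof -
  let ?R = "\<lambda>c xs ys. \<exists>x. xs = x # ys \<and> P c x"
  have "re (\<lambda>c. (?R c)\<^sup>*\<^sup>* (xs c) [])"
    by (intro comp assms re_comp2[OF assms(1)])
  moreover have "(?R c)\<^sup>*\<^sup>* ys [] \<longleftrightarrow> (\<forall>x\<in>set ys. P c x)" for c ys
  proof
    have "(?R c)\<^sup>*\<^sup>* ys zs \<Longrightarrow> zs = [] \<Longrightarrow> \<forall>x\<in>set ys. P c x" for zs
      by (induction rule: converse_rtranclp_induct) auto
    then show "(?R c)\<^sup>*\<^sup>* ys [] \<Longrightarrow> \<forall>x\<in>set ys. P c x" by blast
    show "\<forall>x\<in>set ys. P c x \<Longrightarrow> (?R c)\<^sup>*\<^sup>* ys []"
      by (induction ys) (auto intro: converse_rtranclp_into_rtranclp)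
  qed
  ultimately show ?thesis by simp
qed

section \<open>Finitary inductive definitions\<close>

inductive derivable :: "('a \<Rightarrow> 'a list \<Rightarrow> bool) \<Rightarrow> 'a \<Rightarrow> bool" for R where
  "R x ys \<Longrightarrow> \<forall>y\<in>set ys. derivable R y \<Longrightarrow> derivable R x"

text \<open>A derivation tree is flattened into a growing list of facts, each justified by facts
  already in the list. Derivability thereby becomes reachability, to which transitive closures
  apply.\<close>

definition derive_step :: "('a \<Rightarrow> 'a list \<Rightarrow> bool) \<Rightarrow> 'a list \<Rightarrow> 'a list \<Rightarrow> bool" where
  "derive_step R L L' \<longleftrightarrow> (\<exists>x ys. L' = x # L \<and> R x ys \<and> (\<forall>y\<in>set ys. y \<in> set L))"

text \<open>A derivation can run on top of facts that are already there, so the derivations of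
  several premises can be put one after the other.\<close>

lemma derive_steps_append:
  assumes "(derive_step R)\<^sup>*\<^sup>* [] L"
  shows "(derive_step R)\<^sup>*\<^sup>* K (L @ K)"
  using assms
proof induction
  case (step L L')
  then have "derive_step R (L @ K) (L' @ K)" by (auto simp: derive_step_def)
  with step.IH show ?case by (rule rtranclp.rtrancl_into_rtrancl)
qed simp

lemma derivable_iff_steps: "derivable R x \<longleftrightarrow> (\<exists>L. (derive_step R)\<^sup>*\<^sup>* [] L \<and> x \<in> set L)"
proof
  assume "derivable R x"
  then show "\<exists>L. (derive_step R)\<^sup>*\<^sup>* [] L \<and> x \<in> set L"
  proof induction
    case (1 x ys)
    from 1(2) have "\<exists>L. (derive_step R)\<^sup>*\<^sup>* [] L \<and> set ys \<subseteq> set L"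
    proof (induction ys)
      case (Cons y ys)
      then have "\<exists>L. (derive_step R)\<^sup>*\<^sup>* [] L \<and> set ys \<subseteq> set L" by auto
      then obtain L where "(derive_step R)\<^sup>*\<^sup>* [] L" "set ys \<subseteq> set L" by blast
      moreover obtain K where "(derive_step R)\<^sup>*\<^sup>* [] K" "y \<in> set K" using Cons by auto
      ultimately show ?case using derive_steps_append[of R K L]
        by (intro exI[of _ "K @ L"]) auto
    qed auto
    then obtain L where L: "(derive_step R)\<^sup>*\<^sup>* [] L" "set ys \<subseteq> set L" by blast
    then have "derive_step R L (x # L)" using 1(1) by (auto simp: derive_step_def)
    with L(1) have "(derive_step R)\<^sup>*\<^sup>* [] (x # L)" by (rule rtranclp.rtrancl_into_rtrancl)
    then show ?case by (intro exI[of _ "x # L"]) simp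
  qed
next
  have "(derive_step R)\<^sup>*\<^sup>* [] L \<Longrightarrow> \<forall>x\<in>set L. derivable R x" for L
  proof (induction rule: rtranclp_induct)
    case (step K L)
    then show ?case
      unfolding derive_step_def using derivable.intros[of R] by (metis set_ConsD)
  qed simp
  then show "\<exists>L. (derive_step R)\<^sup>*\<^sup>* [] L \<and> x \<in> set L \<Longrightarrow> derivable R x" by blast
qed

lemma re_derivable [comp]:
  assumes "re (\<lambda>q. R (fst q) (fst (snd q)) (snd (snd q)))" "cf f"
  shows "re (\<lambda>c. derivable (R c) (f c))"
  unfolding derivable_iff_steps derive_step_def[abs_def]
  by (intro comp re_comp3[OF assms(1)] cf_comp[OF assms(2)])

section \<open>Integers and rational numbers\<close>

instantiation int :: godel
begin
text \<open>Positive and negative part, one of them 0. Integer arithmetic then reduces to natural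
  numbers without a distinction of signs.\<close>

definition godel_int :: "int \<Rightarrow> nat" where "godel_int i = prod_encode (nat i, nat (- i))"
instance
proof
  show "inj (godel :: int \<Rightarrow> nat)"
    by (auto simp: inj_def godel_int_def eq_nat_nat_iff)
  have "range (godel :: int \<Rightarrow> nat) = {n. \<exists>a b. n = prod_encode (a, b) \<and> (a = 0 \<or> b = 0)}"
    (is "?A = ?B")
  proof (intro equalityI subsetI)
    fix n assume "n \<in> ?B"
    then obtain a b where "n = prod_encode (a, b)" "a = 0 \<or> b = 0" by blast
    then have "n = godel (int a - int b)" by (auto simp: godel_int_def)
    then show "n \<in> ?A" by simp
  qed (auto simp: godel_int_def)
  moreover have "re (\<lambda>n. \<exists>a b. n = prod_encode (a, b) \<and> (a = 0 \<or> b = 0))"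
    by (intro comp)
  ultimately show "re_set (range (godel :: int \<Rightarrow> nat))"
    by (intro re_nat_setD) simp
qed
end

lemma cf_nat [comp]:
  fixes f :: "'a :: godel \<Rightarrow> int"
  assumes "cf f"
  shows "cf (\<lambda>x. nat (f x))"
proof (rule cf_graphI)
  have "re (\<lambda>p. \<exists>b. godel (f (fst p)) = prod_encode (snd p, b))"
    by (intro comp cf_comp[OF assms])
  then show "re (\<lambda>p. snd p = nat (f (fst p)))"
    by (rule back_subst[of re]) (auto simp: godel_int_def)
qed

lemma cf_nat_uminus:
  fixes f :: "'a :: godel \<Rightarrow> int"
  assumes "cf f"
  shows "cf (\<lambda>x. nat (- f x))"
proof (rule cf_graphI)
  have "re (\<lambda>p. \<exists>b. godel (f (fst p)) = prod_encode (b, snd p))"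
    by (intro comp cf_comp[OF assms])
  then show "re (\<lambda>p. snd p = nat (- f (fst p)))"
    by (rule back_subst[of re]) (auto simp: godel_int_def)
qed

text \<open>Moving the negative parts across the equation leaves only additions of natural numbers.
  Sums and products of integers are later written as differences of this kind.\<close>

lemma cf_int_diff:
  fixes f g :: "'a :: godel \<Rightarrow> nat"
  assumes "cf f" "cf g"
  shows "cf (\<lambda>x. int (f x) - int (g x))"
proof (rule cf_graphI)
  have "re (\<lambda>p. f (fst p) + nat (- snd p) = g (fst p) + nat (snd p))"
    by (intro comp cf_nat_uminus cf_comp[OF assms(1)] cf_comp[OF assms(2)])
  then show "re (\<lambda>p. snd p = int (f (fst p)) - int (g (fst p)))"
    by (rule back_subst[of re]) (auto simp: fun_eq_iff)
qed

lemma cf_int [comp]: "cf f \<Longrightarrow> cf (\<lambda>x. int (f x))"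
  using cf_int_diff[of f "\<lambda>_. 0"] by (simp add: cf_const)

lemma
  fixes f g :: "'a :: godel \<Rightarrow> int"
  assumes f: "cf f" and g: "cf g"
  shows cf_plus_int [comp]: "cf (\<lambda>x. f x + g x)"
    and cf_times_int [comp]: "cf (\<lambda>x. f x * g x)"
    and cf_less_int [comp]: "cf (\<lambda>x. f x < g x)"
proof -
  have "cf (\<lambda>x. int (nat (f x) + nat (g x)) - int (nat (- f x) + nat (- g x)))"
    by (intro comp cf_int_diff cf_nat_uminus f g)
  then show "cf (\<lambda>x. f x + g x)"
    by (rule back_subst[of cf]) auto
  have "i * j = int (nat i * nat j + nat (- i) * nat (- j)) - int (nat i * nat (- j) + nat (- i) * nat j)"
    for i j :: int
  proof -
    have "i * j = (int (nat i) - int (nat (- i))) * (int (nat j) - int (nat (- j)))"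
      by (cases "0 \<le> i"; cases "0 \<le> j") simp_all
    then show ?thesis by (simp add: algebra_simps)
  qed
  note eq = this
  show "cf (\<lambda>x. f x * g x)"
    unfolding eq by (intro comp cf_int_diff cf_nat_uminus f g)
  have "cf (\<lambda>x. nat (f x) + nat (- g x) < nat (g x) + nat (- f x))"
    by (intro comp cf_nat_uminus f g)
  moreover have "nat i + nat (- j) < nat j + nat (- i) \<longleftrightarrow> i < j" for i j by linarith
  ultimately show "cf (\<lambda>x. f x < g x)" by simp
qed

lemma cf_abs_int [comp]:
  fixes f :: "'a :: godel \<Rightarrow> int"
  assumes "cf f" shows "cf (\<lambda>x. \<bar>f x\<bar>)"
proof -
  have "cf (\<lambda>x. int (nat (f x) + nat (- f x)))" by (intro comp cf_nat_uminus assms)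
  then show ?thesis by (rule back_subst[of cf]) auto
qed

text \<open>In Bezout form, coprimality of numerator and denominator is an existential statement, so
  the reduced fractions are visibly enumerable.\<close>

lemma range_quotient_of_iff:
  "p \<in> range quotient_of \<longleftrightarrow> 0 < snd p \<and> (\<exists>u v. u * fst p + v * snd p = 1)"
proof -
  have "coprime a b \<longleftrightarrow> (\<exists>u v. u * a + v * b = 1)" for a b :: int
  proof
    assume "coprime a b"
    then show "\<exists>u v. u * a + v * b = 1" using bezout_int[of a b] by simp
  next
    assume "\<exists>u v. u * a + v * b = 1"
    then show "coprime a b"
      by (metis coprimeI dvd_add dvd_mult)
  qed
  moreover have "p \<in> range quotient_of \<longleftrightarrow> 0 < snd p \<and> coprime (fst p) (snd p)"
  proof
    assume "p \<in> range quotient_of"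
    then show "0 < snd p \<and> coprime (fst p) (snd p)"
      by (metis imageE prod.collapse quotient_of_coprime quotient_of_denom_pos)
  next
    assume "0 < snd p \<and> coprime (fst p) (snd p)"
    then have "quotient_of (Fract (fst p) (snd p)) = p"
      by (cases p) (simp add: quotient_of_Fract normalize_stable)
    then show "p \<in> range quotient_of" by (metis rangeI)
  qed
  ultimately show ?thesis by simp
qed

instantiation rat :: godel
begin
definition godel_rat :: "rat \<Rightarrow> nat" where "godel_rat q = godel (quotient_of q)"
instance
proof
  show "inj (godel :: rat \<Rightarrow> nat)"
    by (auto simp: inj_def godel_rat_def quotient_of_inject)
  have "range (godel :: rat \<Rightarrow> nat) = godel ` range quotient_of"
    by (auto simp: godel_rat_def)
  moreover have "re (\<lambda>p. p \<in> range quotient_of)"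
    unfolding range_quotient_of_iff by (intro comp re_cfI)
  ultimately show "re_set (range (godel :: rat \<Rightarrow> nat))"
    by (simp add: re_def)
qed
end

lemma cf_quotient_of [comp]:
  assumes "cf f" shows "cf (\<lambda>x. quotient_of (f x))"
proof (rule cf_graphI)
  have "re (\<lambda>p. godel (snd p :: int \<times> int) = godel (f (fst p)))"
    by (intro comp cf_comp[OF assms])
  then show "re (\<lambda>p. snd p = quotient_of (f (fst p)))"
    by (simp add: godel_rat_def)
qed

lemma rat_conv_quotient: "q = Fract (fst (quotient_of q)) (snd (quotient_of q))"
  and quotient_denom_pos: "0 < snd (quotient_of q)"
proof -
  obtain a b where "quotient_of q = (a, b)" by (cases "quotient_of q")
  then show "q = Fract (fst (quotient_of q)) (snd (quotient_of q))" "0 < snd (quotient_of q)"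
    using quotient_of_div[of q a b] quotient_of_denom_pos[of q a b] by (auto simp: Fract_of_int_quotient)
qed

lemma cf_Fract [comp]:
  assumes f: "cf f" and g: "cf g" shows "cf (\<lambda>x. Fract (f x) (g x))"
proof (rule cf_graphI)
  \<comment> \<open>A fraction with denominator 0 is 0 by convention and needs its own case;
    otherwise equality of fractions is cross multiplication.\<close>
  have "re (\<lambda>p. g (fst p) = 0 \<and> snd p = 0 \<or> g (fst p) \<noteq> 0 \<and>
      fst (quotient_of (snd p)) * g (fst p) = f (fst p) * snd (quotient_of (snd p)))"
    by (intro comp cf_comp[OF f] cf_comp[OF g])
  moreover have eq: "q = Fract a b \<longleftrightarrow> b = 0 \<and> q = 0 \<or>
      b \<noteq> 0 \<and> fst (quotient_of q) * b = a * snd (quotient_of q)" for q a b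
    using rat_conv_quotient[of q] quotient_denom_pos[of q]
    by (cases "b = 0") (auto simp: rat_number_collapse eq_rat(1)[symmetric])
  ultimately show "re (\<lambda>p. snd p = Fract (f (fst p)) (g (fst p)))"
    unfolding eq by simp
qed

lemma
  fixes f g :: "'a :: godel \<Rightarrow> rat"
  assumes f: "cf f" and g: "cf g"
  shows cf_plus_rat [comp]: "cf (\<lambda>x. f x + g x)"
    and cf_times_rat [comp]: "cf (\<lambda>x. f x * g x)"
    and cf_less_rat [comp]: "cf (\<lambda>x. f x < g x)"
proof -
  let ?n = "\<lambda>q. fst (quotient_of q)" and ?d = "\<lambda>q. snd (quotient_of q)"
  have eq1: "q + r = Fract (?n q * ?d r + ?n r * ?d q) (?d q * ?d r)" for q r
    by (metis add_rat rat_conv_quotient quotient_denom_pos order_less_irrefl)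
  have eq2: "q * r = Fract (?n q * ?n r) (?d q * ?d r)" for q r
    by (metis mult_rat rat_conv_quotient)
  have eq3: "q < r \<longleftrightarrow> ?n q * ?d r < ?d q * ?n r" for q r
    by (simp only: rat_less_code Let_def case_prod_unfold)
  show "cf (\<lambda>x. f x + g x)" unfolding eq1 by (intro comp f g)
  show "cf (\<lambda>x. f x * g x)" unfolding eq2 by (intro comp f g)
  show "cf (\<lambda>x. f x < g x)" unfolding eq3 by (intro comp f g)
qed

lemma
  fixes f g :: "'a :: godel \<Rightarrow> rat"
  assumes "cf f" "cf g"
  shows cf_minus_rat [comp]: "cf (\<lambda>x. f x - g x)"
    and re_less_rat [comp]: "re (\<lambda>x. f x < g x)"
    and re_le_rat [comp]: "re (\<lambda>x. f x \<le> g x)"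
proof -
  have "cf (\<lambda>x. f x + (-1) * g x)" by (intro comp assms)
  then show "cf (\<lambda>x. f x - g x)" by simp
  show "re (\<lambda>x. f x < g x)" by (intro re_cfI comp assms)
  show "re (\<lambda>x. f x \<le> g x)" unfolding not_less[symmetric] by (intro re_not_cf comp assms)
qed

lemma cf_of_nat_rat [comp]:
  assumes "cf f" shows "cf (\<lambda>x. of_nat (f x) :: rat)"
  unfolding of_nat_rat by (intro comp assms)

instantiation move :: godel
begin
primrec godel_move :: "move \<Rightarrow> nat" where
  "godel_move GoLeft = 0" | "godel_move GoRight = 1" | "godel_move Stay = 2"
instance
proof
  show "inj (godel :: move \<Rightarrow> nat)"
  proof (rule injI)
    fix x y :: move assume "godel x = godel y"
    then show "x = y" by (cases x; cases y) auto
  qed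
  have "range (godel :: move \<Rightarrow> nat) = {n. n = 0 \<or> n = 1 \<or> n = 2}" (is "?A = ?B")
  proof (intro equalityI subsetI)
    fix n assume "n \<in> ?B"
    then consider "n = godel GoLeft" | "n = godel GoRight" | "n = godel Stay" by auto
    then show "n \<in> ?A" by cases (metis rangeI)+
  next
    fix n assume "n \<in> ?A"
    then obtain m :: move where "n = godel m" by auto
    then show "n \<in> ?B" by (cases m) auto
  qed
  moreover have "re (\<lambda>n :: nat. n = 0 \<or> n = 1 \<or> n = 2)" by (intro comp)
  ultimately show "re_set (range (godel :: move \<Rightarrow> nat))"
    by (intro re_nat_setD) simp
qed
end

lemma cf_case_move [comp]:
  assumes "cf m" "cf f" "cf g" "cf h"
  shows "cf (\<lambda>x. case m x of GoLeft \<Rightarrow> f x | GoRight \<Rightarrow> g x | Stay \<Rightarrow> h x)"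
proof -
  have "cf (\<lambda>x. if m x = GoLeft then f x else if m x = GoRight then g x else h x)"
    by (intro comp assms)
  then show ?thesis by (rule back_subst[of cf]) (auto simp: fun_eq_iff split: move.split)
qed

section \<open>Machines and encodings\<close>

lemma cf_tl [comp]: "cf f \<Longrightarrow> cf (\<lambda>x. tl (f x))"
  unfolding tl_def by (intro comp)

lemma cf_cell [comp]: "cf f \<Longrightarrow> cf (\<lambda>x. cell (f x))"
  unfolding cell_def by (intro comp)

lemma cf_tm_step [comp]:
  assumes "cf M" "cf c" shows "cf (\<lambda>x. tm_step (M x) (c x))"
proof -
  have eq: "tm_step N d = tm_step N (fst d, fst (snd d), snd (snd d))" for N d by simp
  show ?thesis
    by (rule cf_comp2[OF _ assms], subst eq, simp only: tm_step.simps case_prod_unfold)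
      (intro comp)
qed

lemma cf_tm_init [comp]: "cf f \<Longrightarrow> cf (\<lambda>x. tm_init (f x))"
  unfolding tm_init_def by (intro comp)

lemma cf_tm_output [comp]:
  assumes "cf f" shows "cf (\<lambda>x. tm_output (f x))"
proof -
  have eq: "tm_output d = tm_output (fst d, fst (snd d), snd (snd d))" for d by simp
  show ?thesis by (subst eq, simp only: tm_output.simps) (intro comp assms)
qed

lemma re_tm_computes [comp]:
  assumes "cf M" "cf w" "cf v"
  shows "re (\<lambda>x. tm_computes (M x) (w x) (v x))"
proof -
  have eq: "tm_computes N u z \<longleftrightarrow> (\<exists>c. (\<lambda>c c'. tm_step N c = Some c')\<^sup>*\<^sup>* (tm_init u) c
      \<and> tm_step N c = None \<and> tm_output c = z)" for N u z
    by (auto simp: tm_computes_def tm_computes_in_def rtranclp_power)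
  show ?thesis
    unfolding eq by (intro comp cf_comp[OF assms(1)] cf_comp[OF assms(2)] cf_comp[OF assms(3)])
qed

lemma cf_enc_nat [comp]:
  assumes "cf f" shows "cf (\<lambda>x. enc_nat (f x))"
proof (rule cf_graphI)
  \<comment> \<open>A state holds the number still to be written and the word written so far. In
    bijective base 2 the least significant digit is 1 for \<open>2 * q + 1\<close> and 2 for
    \<open>2 * q + 2\<close>, and in both cases \<open>q\<close> remains.\<close>
  let ?R = "\<lambda>p q. fst p = 2 * fst q + 1 \<and> snd q = snd p @ [True, False] \<or>
    fst p = 2 * fst q + 2 \<and> snd q = snd p @ [True, True]"
  have "re (\<lambda>p. \<exists>w. ?R\<^sup>*\<^sup>* (f (fst p), []) (0, w) \<and> snd p = w @ [False])"
    by (intro comp cf_comp[OF assms])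
  moreover have "?R\<^sup>*\<^sup>* (n, u) (0, w) \<longleftrightarrow> u @ enc_nat n = w @ [False]" for n u w
  proof
    have "?R\<^sup>*\<^sup>* p q \<Longrightarrow> fst q = 0 \<Longrightarrow> snd p @ enc_nat (fst p) = snd q @ [False]" for p q
    proof (induction rule: converse_rtranclp_induct)
      case base
      then show ?case by (simp add: enc_nat.simps[of 0])
    next
      case (step p p')
      then have "snd p @ enc_nat (fst p) = snd p' @ enc_nat (fst p')"
        by (subst enc_nat.simps) auto
      with step show ?case by simp
    qed
    from this[of "(n, u)" "(0, w)"] show "?R\<^sup>*\<^sup>* (n, u) (0, w) \<Longrightarrow> u @ enc_nat n = w @ [False]"
      by simp
    show "u @ enc_nat n = w @ [False] \<Longrightarrow> ?R\<^sup>*\<^sup>* (n, u) (0, w)"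
    proof (induction n arbitrary: u rule: less_induct)
      case (less n)
      show ?case
      proof (cases "n = 0")
        case True
        with less.prems show ?thesis by (simp add: enc_nat.simps[of 0])
      next
        case False
        let ?q = "((n - 1) div 2, u @ [True, even n])"
        have "?R\<^sup>*\<^sup>* ?q (0, w)"
          using False less.prems by (intro less.IH) (auto simp: enc_nat.simps[of n])
        moreover have "?R (n, u) ?q"
          using False by (cases "even n") (auto elim!: evenE oddE)
        ultimately show ?thesis by (intro converse_rtranclp_into_rtranclp[of ?R "(n, u)" ?q])
      qed
    qed
  qed
  ultimately have "re (\<lambda>p. \<exists>w. [] @ enc_nat (f (fst p)) = w @ [False] \<and> snd p = w @ [False])" by simp
  moreover have "\<exists>w. enc_nat n = w @ [False]" for n
  proof (induction n rule: less_induct)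
    case (less n)
    show ?case
    proof (cases "n = 0")
      case False
      then have "(n - 1) div 2 < n" by simp
      from less[OF this] obtain w where "enc_nat ((n - 1) div 2) = w @ [False]" by blast
      with False show ?thesis
        by (subst enc_nat.simps) (auto intro: exI[of _ "True # even n # w"])
    qed (simp add: enc_nat.simps[of 0])
  qed
  ultimately show "re (\<lambda>p. snd p = enc_nat (f (fst p)))"
    by (elim back_subst[of re]) (auto simp: fun_eq_iff)
qed

lemma cf_enc_rat [comp]: "cf f \<Longrightarrow> cf (\<lambda>x. enc_rat (f x))"
  unfolding enc_rat_def case_prod_beta by (intro comp)

lemma cf_enc_interval [comp]: "cf f \<Longrightarrow> cf (\<lambda>x. enc_interval (f x))"
  unfolding enc_interval_def by (intro comp)

lemma cf_enc_list [comp]: "cf f \<Longrightarrow> cf (\<lambda>x. enc_list (f x))"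
  unfolding enc_list_def by (intro comp)

lemma cf_enc_box [comp]: "cf f \<Longrightarrow> cf (\<lambda>x. enc_box (f x))"
  unfolding enc_box_def by (intro comp)

lemma cf_enc_move [comp]:
  assumes "cf f" shows "cf (\<lambda>x. enc_move (f x))"
proof -
  have eq: "enc_move m = (case m of GoLeft \<Rightarrow> [False, False] | GoRight \<Rightarrow> [False, True]
      | Stay \<Rightarrow> [True, False])" for m by (cases m) auto
  show ?thesis unfolding eq by (intro comp assms)
qed

lemma cf_enc_instr [comp]:
  assumes "cf f" shows "cf (\<lambda>x. enc_instr (f x))"
proof -
  have eq: "enc_instr i = enc_nat (fst (fst i)) @ enc_nat (snd (fst i)) @ enc_nat (fst (snd i))
    @ enc_nat (fst (snd (snd i))) @ enc_move (snd (snd (snd i)))" for i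
    by (cases i rule: enc_instr.cases) simp
  show ?thesis unfolding eq by (intro comp assms)
qed

lemma cf_enc_tm [comp]: "cf f \<Longrightarrow> cf (\<lambda>x. enc_tm (f x))"
  unfolding enc_tm_def by (intro comp)

lemma cf_str_code [comp]:
  assumes "cf f" shows "cf (\<lambda>x. str_code (f x))"
proof -
  have eq: "str_code w = foldr (\<lambda>b n. 2 * n + (if b then 2 else 1)) w 0" for w
    by (induction w) auto
  show ?thesis unfolding eq by (intro comp assms)
qed

section \<open>Words that encode terms and formulas\<close>

definition term_rule :: "bool list \<Rightarrow> bool list list \<Rightarrow> bool" where
  "term_rule w us \<longleftrightarrow>
     (\<exists>x. w = [False, False, False] @ enc_nat x \<and> us = []) \<or>
     w = [False, False, True] \<and> us = [] \<or>
     w = [False, True, False] \<and> us = [] \<or>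
     (\<exists>s t. w = [False, True, True] @ s @ t \<and> us = [s, t]) \<or>
     (\<exists>s t. w = [True, False, False] @ s @ t \<and> us = [s, t]) \<or>
     (\<exists>g. w = [True, False, True] @ enc_tm g @ enc_list us)"

lemma term_ruleI:
  "term_rule (enc_term (Var x)) []" "term_rule (enc_term Zero) []" "term_rule (enc_term One) []"
  "term_rule (enc_term (Add s t)) [enc_term s, enc_term t]"
  "term_rule (enc_term (Mul s t)) [enc_term s, enc_term t]"
  "term_rule (enc_term (Fun g ts)) (map enc_term ts)"
  by (auto simp: term_rule_def)

text \<open>The rules are about words, since \<open>ecf_term\<close> becomes an instance of
  \<open>godel\<close> only through this description of its range. A premise of a rule may be any
  word; the induction over derivations turns it into the encoding of a term.\<close>

lemma range_enc_term: "range enc_term = {w. derivable term_rule w}"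
proof (intro equalityI subsetI)
  fix w assume "w \<in> range enc_term"
  then obtain t where "w = enc_term t" ..
  moreover have "derivable term_rule (enc_term t)"
  proof (induction t)
    case (Fun g ts)
    then show ?case by (intro derivable.intros[of term_rule, OF term_ruleI(6)]) auto
  qed (rule derivable.intros, rule term_ruleI, simp del: enc_term.simps)+
  ultimately show "w \<in> {w. derivable term_rule w}" by simp
next
  fix w assume "w \<in> {w. derivable term_rule w}"
  then have "derivable term_rule w" by simp
  then show "w \<in> range enc_term"
  proof induction
    case (1 w us)
    then obtain ts where us: "us = map enc_term ts"
      by (metis (no_types, lifting) ex_map_conv imageE)
    from 1(1) consider (var) x where "w = enc_term (Var x)" | "w = enc_term Zero"
      | "w = enc_term One" | (add) s t where "w = [False, True, True] @ s @ t" "us = [s, t]"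
      | (mul) s t where "w = [True, False, False] @ s @ t" "us = [s, t]"
      | (fun_app) g where "w = [True, False, True] @ enc_tm g @ enc_list us"
      unfolding term_rule_def by auto
    then show ?case
    proof cases
      case (add s t)
      then obtain s' t' where "w = enc_term (Add s' t')" using us by auto
      then show ?thesis by blast
    next
      case (mul s t)
      then obtain s' t' where "w = enc_term (Mul s' t')" using us by auto
      then show ?thesis by blast
    next
      case (fun_app g)
      then have "w = enc_term (Fun g ts)" using us by simp
      then show ?thesis by blast
    qed blast+
  qed
qed

text \<open>Terms and formulas are coded through their bit strings, which makes the encoders trivially
  computable.\<close>

instantiation ecf_term :: godel
begin
definition godel_ecf_term :: "ecf_term \<Rightarrow> nat" where "godel_ecf_term t = godel (enc_term t)"
instance
proof
  show "inj (godel :: ecf_term \<Rightarrow> nat)"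
  proof (rule injI)
    fix s t :: ecf_term assume "godel s = godel t"
    then show "s = t" using enc_term_prefix[of s "[]" t "[]"] by (simp add: godel_ecf_term_def)
  qed
  have "range (godel :: ecf_term \<Rightarrow> nat) = godel ` range enc_term"
    by (auto simp: godel_ecf_term_def)
  moreover have "re (\<lambda>w. derivable term_rule w)"
    unfolding term_rule_def by (intro comp)
  ultimately show "re_set (range (godel :: ecf_term \<Rightarrow> nat))"
    by (simp add: re_def range_enc_term)
qed
end

lemma cf_enc_term [comp]:
  assumes "cf f" shows "cf (\<lambda>x. enc_term (f x))"
proof (rule cf_graphI)
  have "re (\<lambda>p. godel (snd p :: bool list) = godel (f (fst p)))"
    by (intro comp cf_comp[OF assms])
  then show "re (\<lambda>p. snd p = enc_term (f (fst p)))"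
    by (simp add: godel_ecf_term_def)
qed

lemma cf_by_enc_term:
  fixes f :: "'a :: godel \<Rightarrow> ecf_term"
  assumes "cf (\<lambda>x. enc_term (f x))" shows "cf f"
proof (rule cf_graphI)
  have "re (\<lambda>p. enc_term (snd p) = enc_term (f (fst p)))"
    by (intro comp cf_comp[OF assms])
  moreover have "enc_term s = enc_term t \<longleftrightarrow> s = t" for s t
    using enc_term_prefix[of s "[]" t "[]"] by simp
  ultimately show "re (\<lambda>p. snd p = f (fst p))" by simp
qed

lemma cf_Var [comp]: "cf f \<Longrightarrow> cf (\<lambda>x. Var (f x))"
  and cf_Add [comp]: "cf s \<Longrightarrow> cf t \<Longrightarrow> cf (\<lambda>x. Add (s x) (t x))"
  and cf_Mul [comp]: "cf s \<Longrightarrow> cf t \<Longrightarrow> cf (\<lambda>x. Mul (s x) (t x))"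
  and cf_Fun [comp]: "cf g \<Longrightarrow> cf ts \<Longrightarrow> cf (\<lambda>x. Fun (g x) (ts x))"
  by (rule cf_by_enc_term, unfold enc_term.simps, intro comp; assumption | rule cf_snd cf_id)+

definition form_rule :: "bool list \<Rightarrow> bool list list \<Rightarrow> bool" where
  "form_rule w us \<longleftrightarrow>
     (\<exists>s t. w = [False, False, False] @ enc_term s @ enc_term t \<and> us = []) \<or>
     (\<exists>s t. w = [False, False, True] @ enc_term s @ enc_term t \<and> us = []) \<or>
     (\<exists>s t. w = [False, True, False] @ s @ t \<and> us = [s, t]) \<or>
     (\<exists>s t. w = [False, True, True] @ s @ t \<and> us = [s, t]) \<or>
     (\<exists>x s. w = [True, False, False] @ enc_nat x @ s \<and> us = [s])"

lemma form_ruleI: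
  "form_rule (enc_form (Less s t)) []" "form_rule (enc_form (Equal s t)) []"
  "form_rule (enc_form (Conj \<phi> \<psi>)) [enc_form \<phi>, enc_form \<psi>]"
  "form_rule (enc_form (Disj \<phi> \<psi>)) [enc_form \<phi>, enc_form \<psi>]"
  "form_rule (enc_form (Exists x \<phi>)) [enc_form \<phi>]"
  by (auto simp: form_rule_def)

lemma range_enc_form: "range enc_form = {w. derivable form_rule w}"
proof (intro equalityI subsetI)
  fix w assume "w \<in> range enc_form"
  then obtain \<phi> where "w = enc_form \<phi>" ..
  moreover have "derivable form_rule (enc_form \<phi>)"
    by (induction \<phi>) (rule derivable.intros, rule form_ruleI, simp del: enc_form.simps)+
  ultimately show "w \<in> {w. derivable form_rule w}" by simp
next
  fix w assume "w \<in> {w. derivable form_rule w}"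
  then have "derivable form_rule w" by simp
  then show "w \<in> range enc_form"
  proof induction
    case (1 w us)
    from 1(1) consider s t where "w = enc_form (Less s t)" | s t where "w = enc_form (Equal s t)"
      | (conj) s t where "w = [False, True, False] @ s @ t" "us = [s, t]"
      | (disj) s t where "w = [False, True, True] @ s @ t" "us = [s, t]"
      | (ex) x s where "w = [True, False, False] @ enc_nat x @ s" "us = [s]"
      unfolding form_rule_def by auto
    then show ?case
    proof cases
      case (conj s t)
      then obtain \<phi> \<psi> where "w = enc_form (Conj \<phi> \<psi>)" using 1(2) by auto
      then show ?thesis by blast
    next
      case (disj s t)
      then obtain \<phi> \<psi> where "w = enc_form (Disj \<phi> \<psi>)" using 1(2) by auto
      then show ?thesis by blast
    next
      case (ex x s)
      then obtain \<phi> where "w = enc_form (Exists x \<phi>)" using 1(2) by auto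
      then show ?thesis by blast
    qed blast+
  qed
qed

instantiation ecf_form :: godel
begin
definition godel_ecf_form :: "ecf_form \<Rightarrow> nat" where "godel_ecf_form \<phi> = godel (enc_form \<phi>)"
instance
proof
  show "inj (godel :: ecf_form \<Rightarrow> nat)"
    using inj_enc_form by (auto simp: inj_def godel_ecf_form_def)
  have "range (godel :: ecf_form \<Rightarrow> nat) = godel ` range enc_form"
    by (auto simp: godel_ecf_form_def)
  moreover have "re (\<lambda>w. derivable form_rule w)"
    unfolding form_rule_def by (intro comp)
  ultimately show "re_set (range (godel :: ecf_form \<Rightarrow> nat))"
    by (simp add: re_def range_enc_form)
qed
end

lemma cf_enc_form [comp]:
  assumes "cf f" shows "cf (\<lambda>x. enc_form (f x))"
proof (rule cf_graphI)
  have "re (\<lambda>p. godel (snd p :: bool list) = godel (f (fst p)))"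
    by (intro comp cf_comp[OF assms])
  then show "re (\<lambda>p. snd p = enc_form (f (fst p)))"
    by (simp add: godel_ecf_form_def)
qed

lemma cf_by_enc_form:
  fixes f :: "'a :: godel \<Rightarrow> ecf_form"
  assumes "cf (\<lambda>x. enc_form (f x))" shows "cf f"
proof (rule cf_graphI)
  have "re (\<lambda>p. enc_form (snd p) = enc_form (f (fst p)))"
    by (intro comp cf_comp[OF assms])
  then show "re (\<lambda>p. snd p = f (fst p))" by (simp add: inj_eq[OF inj_enc_form])
qed

lemma cf_Less [comp]: "cf s \<Longrightarrow> cf t \<Longrightarrow> cf (\<lambda>x. Less (s x) (t x))"
  and cf_Equal [comp]: "cf s \<Longrightarrow> cf t \<Longrightarrow> cf (\<lambda>x. Equal (s x) (t x))"
  and cf_Conj [comp]: "cf \<phi> \<Longrightarrow> cf \<psi> \<Longrightarrow> cf (\<lambda>x. Conj (\<phi> x) (\<psi> x))"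
  and cf_Disj [comp]: "cf \<phi> \<Longrightarrow> cf \<psi> \<Longrightarrow> cf (\<lambda>x. Disj (\<phi> x) (\<psi> x))"
  and cf_Exists [comp]: "cf n \<Longrightarrow> cf \<phi> \<Longrightarrow> cf (\<lambda>x. Exists (n x) (\<phi> x))"
  by (rule cf_by_enc_form, unfold enc_form.simps, intro comp; assumption | rule cf_snd cf_id)+

section \<open>Interval evaluation\<close>

type_synonym interval = "rat \<times> rat"

type_synonym box_env = "(nat \<times> interval) list"

text \<open>Constants get nondegenerate intervals because a code is only meaningful on boxes with
  nonempty sides.  In a product, r bounds the modulus of x * y - a * c = x * (y - c) + c * (x - a);
  using z * z + 1 as a bound of the modulus of z keeps everything polynomial.\<close>

inductive ieval :: "nat \<Rightarrow> box_env \<Rightarrow> ecf_term \<Rightarrow> interval \<Rightarrow> bool" for k E where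
  "map_of E x = Some I \<Longrightarrow> ieval k E (Var x) I"
| "ieval k E Zero (- Fract 1 (int (Suc k)), Fract 1 (int (Suc k)))"
| "ieval k E One (1 - Fract 1 (int (Suc k)), 1 + Fract 1 (int (Suc k)))"
| "ieval k E s (a, b) \<Longrightarrow> ieval k E t (c, d) \<Longrightarrow> ieval k E (Add s t) (a + c, b + d)"
| "ieval k E s (a, b) \<Longrightarrow> ieval k E t (c, d) \<Longrightarrow>
     r = (a * a + b * b + 1) * (d - c) + (c * c + 1) * (b - a) \<Longrightarrow>
     ieval k E (Mul s t) (a * c - r, a * c + r)"
| "list_all2 (ieval k E) ts Is \<Longrightarrow> tm_computes g (enc_box Is) (enc_interval J) \<Longrightarrow>
     ieval k E (Fun g ts) J"

text \<open>A quantifier prepends its variable to \<open>E\<close>, and \<open>map_of\<close>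
  returns the first entry, so inner quantifiers shadow outer ones. The condition
  \<open>0 < of_nat m + a\<close> is \<open>-m < a\<close> without a negative number.\<close>

primrec approx :: "nat \<Rightarrow> nat \<Rightarrow> ecf_form \<Rightarrow> box_env \<Rightarrow> bool" where
  "approx m k (Less s t) E \<longleftrightarrow>
     (\<exists>I J. ieval k E s I \<and> ieval k E t J \<and> fst I + Fract 1 (int (Suc m)) < snd J)"
| "approx m k (Equal s t) E \<longleftrightarrow>
     (\<exists>I J. ieval k E s I \<and> ieval k E t J \<and> fst I < snd J \<and> fst J < snd I)"
| "approx m k (Conj \<phi> \<psi>) E \<longleftrightarrow> approx m k \<phi> E \<and> approx m k \<psi> E"
| "approx m k (Disj \<phi> \<psi>) E \<longleftrightarrow> approx m k \<phi> E \<or> approx m k \<psi> E"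
| "approx m k (Exists x \<phi>) E \<longleftrightarrow>
     (\<exists>a b. 0 < of_nat m + a \<and> b < of_nat m \<and> a < b \<and> b < a + Fract 1 (int (Suc k)) \<and>
       approx m k \<phi> ((x, (a, b)) # E))"

text \<open>The clauses of \<open>ieval\<close>, phrased with operations covered by the closure
  rules, hence the factor \<open>-1\<close> in place of a sign. The premises pair each argument with
  its interval, which takes the place of \<open>list_all2\<close>.\<close>

definition ieval_rule :: "nat \<times> box_env \<Rightarrow> ecf_term \<times> interval \<Rightarrow> (ecf_term \<times> interval) list \<Rightarrow> bool"
where
  "ieval_rule p v us \<longleftrightarrow>
     (\<exists>x I. map_of (snd p) x = Some I \<and> v = (Var x, I) \<and> us = []) \<or>
     v = (Zero, (-1) * Fract 1 (int (Suc (fst p))), Fract 1 (int (Suc (fst p)))) \<and> us = [] \<or>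
     v = (One, 1 - Fract 1 (int (Suc (fst p))), 1 + Fract 1 (int (Suc (fst p)))) \<and> us = [] \<or>
     (\<exists>s a b t c d. v = (Add s t, (a + c, b + d)) \<and> us = [(s, (a, b)), (t, (c, d))]) \<or>
     (\<exists>s a b t c d r. v = (Mul s t, (a * c - r, a * c + r)) \<and> us = [(s, (a, b)), (t, (c, d))] \<and>
       r = (a * a + b * b + 1) * (d - c) + (c * c + 1) * (b - a)) \<or>
     (\<exists>g J. v = (Fun g (map fst us), J) \<and>
       tm_computes g (enc_box (map snd us)) (enc_interval J))"

lemma ieval_iff_derivable: "ieval k E t I \<longleftrightarrow> derivable (ieval_rule (k, E)) (t, I)"
proof
  assume "ieval k E t I"
  then show "derivable (ieval_rule (k, E)) (t, I)"
  proof (induction)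
    case (1 x I)
    then show ?case by (intro derivable.intros[of _ _ "[]"]) (auto simp: ieval_rule_def)
  next
    case 2
    then show ?case by (intro derivable.intros[of _ _ "[]"]) (auto simp: ieval_rule_def)
  next
    case 3
    then show ?case by (intro derivable.intros[of _ _ "[]"]) (auto simp: ieval_rule_def)
  next
    case (4 s a b t c d)
    then show ?case
      by (intro derivable.intros[of _ _ "[(s, (a, b)), (t, (c, d))]"]) (auto simp: ieval_rule_def)
  next
    case (5 s a b t c d r)
    then show ?case
      by (intro derivable.intros[of _ _ "[(s, (a, b)), (t, (c, d))]"]) (auto simp: ieval_rule_def)
  next
    case (6 ts Is g J)
    then have "length ts = length Is" by (auto dest: list_all2_lengthD)
    with 6 show ?case
      by (intro derivable.intros[of _ _ "zip ts Is"]) (auto simp: ieval_rule_def list_all2_iff)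
  qed
next
  have "ieval k E (fst v) (snd v)" if "derivable (ieval_rule (k, E)) v" for v
    using that
  proof induction
    case (1 v us)
    from 1(1) consider x I where "map_of E x = Some I" "v = (Var x, I)"
      | "v = (Zero, - Fract 1 (int (Suc k)), Fract 1 (int (Suc k)))"
      | "v = (One, 1 - Fract 1 (int (Suc k)), 1 + Fract 1 (int (Suc k)))"
      | (add) s a b t c d where "v = (Add s t, (a + c, b + d))" "us = [(s, (a, b)), (t, (c, d))]"
      | (mul) s a b t c d r where "v = (Mul s t, (a * c - r, a * c + r))" "us = [(s, (a, b)), (t, (c, d))]"
          "r = (a * a + b * b + 1) * (d - c) + (c * c + 1) * (b - a)"
      | (fun_app) g J where "v = (Fun g (map fst us), J)"
          "tm_computes g (enc_box (map snd us)) (enc_interval J)"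
      unfolding ieval_rule_def by fastforce
    then show ?case
    proof cases
      case (fun_app g J)
      have "list_all2 (ieval k E) (map fst us) (map snd us)"
        using 1(2) by (auto simp: list_all2_conv_all_nth)
      with fun_app show ?thesis by (auto intro: ieval.intros)
    qed (use 1(2) ieval.intros(2,3)[of k E] in \<open>auto intro: ieval.intros\<close>)
  qed
  from this[of "(t, I)"] show "derivable (ieval_rule (k, E)) (t, I) \<Longrightarrow> ieval k E t I" by simp
qed

lemma re_ieval [comp]:
  assumes "cf k" "cf E" "cf t" "cf I"
  shows "re (\<lambda>x. ieval (k x) (E x) (t x) (I x))"
  unfolding ieval_iff_derivable ieval_rule_def
  by (intro comp cf_comp[OF assms(1)] cf_comp[OF assms(2)] cf_comp[OF assms(3)] cf_comp[OF assms(4)])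

text \<open>The environment belongs to the judgement since \<open>Exists\<close> extends it, whereas
  bound and precision stay fixed and form the parameter \<open>p\<close>.\<close>

definition approx_rule ::
  "nat \<times> nat \<Rightarrow> ecf_form \<times> box_env \<Rightarrow> (ecf_form \<times> box_env) list \<Rightarrow> bool"
where
  "approx_rule p v us \<longleftrightarrow>
     (\<exists>s t I J. fst v = Less s t \<and> ieval (snd p) (snd v) s I \<and> ieval (snd p) (snd v) t J \<and>
        fst I + Fract 1 (int (Suc (fst p))) < snd J \<and> us = []) \<or>
     (\<exists>s t I J. fst v = Equal s t \<and> ieval (snd p) (snd v) s I \<and> ieval (snd p) (snd v) t J \<and>
        fst I < snd J \<and> fst J < snd I \<and> us = []) \<or>
     (\<exists>\<phi> \<psi>. fst v = Conj \<phi> \<psi> \<and> us = [(\<phi>, snd v), (\<psi>, snd v)]) \<or>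
     (\<exists>\<phi> \<psi>. fst v = Disj \<phi> \<psi> \<and> (us = [(\<phi>, snd v)] \<or> us = [(\<psi>, snd v)])) \<or>
     (\<exists>x \<phi> a b. fst v = Exists x \<phi> \<and> 0 < of_nat (fst p) + a \<and> b < of_nat (fst p) \<and> a < b \<and>
        b < a + Fract 1 (int (Suc (snd p))) \<and> us = [(\<phi>, (x, (a, b)) # snd v)])"

lemma derivable_iff: "derivable R x \<longleftrightarrow> (\<exists>ys. R x ys \<and> (\<forall>y\<in>set ys. derivable R y))"
  by (subst derivable.simps) auto

lemma approx_iff_derivable: "approx m k \<phi> E \<longleftrightarrow> derivable (approx_rule (m, k)) (\<phi>, E)"
proof (induction \<phi> arbitrary: E)
  case (Less s t)
  have "approx_rule (m, k) (Less s t, E) us \<longleftrightarrow> us = [] \<and> approx m k (Less s t) E" for us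
    by (auto simp: approx_rule_def)
  then show ?case by (subst derivable_iff) simp
next
  case (Equal s t)
  have "approx_rule (m, k) (Equal s t, E) us \<longleftrightarrow> us = [] \<and> approx m k (Equal s t) E" for us
    by (auto simp: approx_rule_def)
  then show ?case by (subst derivable_iff) simp
next
  case (Conj \<phi> \<psi>)
  have "approx_rule (m, k) (Conj \<phi> \<psi>, E) us \<longleftrightarrow> us = [(\<phi>, E), (\<psi>, E)]" for us
    by (auto simp: approx_rule_def)
  then show ?case by (subst derivable_iff) (simp add: Conj)
next
  case (Disj \<phi> \<psi>)
  have "approx_rule (m, k) (Disj \<phi> \<psi>, E) us \<longleftrightarrow> us = [(\<phi>, E)] \<or> us = [(\<psi>, E)]" for us
    by (auto simp: approx_rule_def)
  then show ?case by (subst derivable_iff) (simp add: Disj conj_disj_distribR ex_disj_distrib)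
next
  case (Exists x \<phi>)
  let ?C = "\<lambda>a b :: rat. 0 < of_nat m + a \<and> b < of_nat m \<and> a < b \<and> b < a + Fract 1 (int (Suc k))"
  have *: "approx_rule (m, k) (Exists x \<phi>, E) us \<longleftrightarrow> (\<exists>a b. ?C a b \<and> us = [(\<phi>, (x, (a, b)) # E)])" for us
    unfolding approx_rule_def fst_conv snd_conv ecf_form.distinct ecf_form.inject simp_thms by blast
  have "(\<exists>us. (\<exists>a b. C a b \<and> us = [f a b]) \<and> (\<forall>y\<in>set us. Q y)) \<longleftrightarrow> (\<exists>a b. C a b \<and> Q (f a b))"
    for C :: "rat \<Rightarrow> rat \<Rightarrow> bool" and f and Q :: "ecf_form \<times> box_env \<Rightarrow> bool"
    by fastforce
  from this[of ?C "\<lambda>a b. (\<phi>, (x, (a, b)) # E)" "derivable (approx_rule (m, k))"] show ?case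
    by (subst derivable_iff) (simp only: * Exists approx.simps conj_assoc)
qed

lemma re_approx [comp]:
  assumes "cf m" "cf k" "cf \<phi>" "cf E"
  shows "re (\<lambda>x. approx (m x) (k x) (\<phi> x) (E x))"
  unfolding approx_iff_derivable approx_rule_def
  by (intro comp cf_comp[OF assms(1)] cf_comp[OF assms(2)] cf_comp[OF assms(3)] cf_comp[OF assms(4)])

section \<open>Enclosures and continuity of coded functions\<close>

abbreviation inside :: "real \<Rightarrow> interval \<Rightarrow> bool" where
  "inside x I \<equiv> real_of_rat (fst I) < x \<and> x < real_of_rat (snd I)"

lemma inside_nonempty: "inside x I \<Longrightarrow> fst I < snd I"
  using of_rat_less[where 'a = real, of "fst I" "snd I"] by linarith

lemma of_rat_inverse_Suc: "real_of_rat (Fract 1 (int (Suc k))) = 1 / (real k + 1)"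
  by (simp add: of_rat_rat)

lemma tm_computes_enc_interval_unique:
  "tm_computes g w (enc_interval I) \<Longrightarrow> tm_computes g w (enc_interval J) \<Longrightarrow> I = J"
  using tm_computes_unique inj_enc_interval by (metis injD)

lemma wf_term_code: "wf_term (Fun g ts) \<Longrightarrow> ecf_code g (length ts) (ecf_fun g (length ts))"
  by (simp add: ecf_fun_def someI_ex)

lemma ecf_code_enclosure:
  assumes "ecf_code g n f" "is_box n B"
  obtains J where "tm_computes g (enc_box B) (enc_interval J)" "\<And>xs. in_box xs B \<Longrightarrow> inside (f xs) J"
proof -
  from assms obtain G where "tm_computes g (enc_box B) (enc_interval (G B))"
    "\<And>xs. in_box xs B \<Longrightarrow> f xs \<in> {of_rat (fst (G B)) <..< of_rat (snd (G B))}"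
    unfolding ecf_code_def by blast
  then show thesis by (intro that[of "G B"]) auto
qed

text \<open>A box has a point, so the output of a code on it encloses a value. In addition, the
  midpoints are as close to a given point as the endpoints are.\<close>

lemma in_box_midpoints:
  assumes "is_box n B"
  shows "in_box (map (\<lambda>I. (real_of_rat (fst I) + real_of_rat (snd I)) / 2) B) B"
  unfolding in_box_def list_all2_conv_all_nth
proof (intro conjI allI impI)
  fix i assume "i < length (map (\<lambda>I. (real_of_rat (fst I) + real_of_rat (snd I)) / 2) B)"
  moreover from this have "fst (B ! i) < snd (B ! i)"
    using assms by (auto simp: is_box_def case_prod_unfold)
  then have "real_of_rat (fst (B ! i)) < real_of_rat (snd (B ! i))" by (simp add: of_rat_less)
  ultimately show "case B ! i of (a, b) \<Rightarrow>
      map (\<lambda>I. (real_of_rat (fst I) + real_of_rat (snd I)) / 2) B ! i \<in> {of_rat a <..< of_rat b}"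
    by (simp add: case_prod_unfold)
qed simp

text \<open>The box \<open>B\<close> is near \<open>xs\<close> but need not contain it, so its
  output need not enclose \<open>f xs\<close>. A second box \<open>C\<close> around
  \<open>xs\<close> links the two: it also contains the midpoints of \<open>B\<close>, hence the
  outputs on \<open>B\<close> and \<open>C\<close> share a value of \<open>f\<close>, and both
  outputs are short.\<close>

lemma ecf_code_near:
  assumes code: "ecf_code g n f" and len: "length xs = n" and \<epsilon>: "\<epsilon> > 0"
  obtains \<delta> where "\<delta> > 0"
    "\<And>B J. is_box n B \<Longrightarrow> tm_computes g (enc_box B) (enc_interval J) \<Longrightarrow>
       \<forall>i<n. \<bar>real_of_rat (fst (B ! i)) - xs ! i\<bar> < \<delta> \<and> \<bar>real_of_rat (snd (B ! i)) - xs ! i\<bar> < \<delta> \<Longrightarrow>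
       \<bar>real_of_rat (fst J) - f xs\<bar> < \<epsilon> \<and> \<bar>real_of_rat (snd J) - f xs\<bar> < \<epsilon>"
proof -
  obtain G where G: "\<And>B. is_box n B \<Longrightarrow> tm_computes g (enc_box B) (enc_interval (G B))"
    "\<And>B xs. is_box n B \<Longrightarrow> in_box xs B \<Longrightarrow>
       f xs \<in> {of_rat (fst (G B)) <..< of_rat (snd (G B))}"
    "\<And>M \<epsilon>. (M::real) > 0 \<Longrightarrow> (\<epsilon>::real) > 0 \<Longrightarrow> \<exists>\<delta> > (0::real). \<forall>B.
           is_box n B \<and>
           (\<forall>(a, b) \<in> set B. {of_rat a <..< of_rat b} \<subseteq> {-M..M}
                             \<and> \<bar>of_rat a - of_rat b\<bar> < \<delta>) \<longrightarrow>
           \<bar>of_rat (fst (G B)) - of_rat (snd (G B))\<bar> < \<epsilon>"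
    using code unfolding ecf_code_def by blast
  have "\<exists>M>0. \<forall>x\<in>set xs. \<bar>x\<bar> + 1 \<le> M"
  proof (induction xs)
    case (Cons x xs)
    then obtain M where "M > 0" "\<forall>x\<in>set xs. \<bar>x\<bar> + 1 \<le> M" by blast
    then show ?case by (intro exI[of _ "max M (\<bar>x\<bar> + 1)"]) fastforce
  qed (auto intro: exI[of _ 1])
  then obtain M where M: "M > 0" "\<And>x. x \<in> set xs \<Longrightarrow> \<bar>x\<bar> + 1 \<le> M" by blast
  have "\<epsilon> / 2 > 0" using \<epsilon> by simp
  from G(3)[OF M(1) this] obtain \<eta> where \<eta>: "\<eta> > 0" "\<And>B. is_box n B \<Longrightarrow>
      \<forall>(a, b) \<in> set B. {of_rat a <..< of_rat b} \<subseteq> {-M..M} \<and> \<bar>real_of_rat a - of_rat b\<bar> < \<eta> \<Longrightarrow>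
      \<bar>real_of_rat (fst (G B)) - of_rat (snd (G B))\<bar> < \<epsilon> / 2"
    by blast
  \<comment> \<open>Endpoints within \<open>2 * \<delta>\<close> of \<open>xs\<close> give sides
    shorter than \<open>4 * \<delta> \<le> \<eta>\<close>; and \<open>2 * \<delta> \<le> 1\<close>
    keeps them in \<open>[-M, M]\<close>, as \<open>M\<close> leaves a margin of 1 around
    \<open>xs\<close>.\<close>
  define \<delta> where "\<delta> = min (1 / 2) (\<eta> / 4)"
  have \<delta>: "\<delta> > 0" "2 * \<delta> \<le> 1" "4 * \<delta> \<le> \<eta>" using \<eta>(1) by (auto simp: \<delta>_def)
  have narrow: "\<bar>real_of_rat (fst (G B)) - of_rat (snd (G B))\<bar> < \<epsilon> / 2"
    if box: "is_box n B" and near: "\<And>i. i < n \<Longrightarrow> \<bar>real_of_rat (fst (B ! i)) - xs ! i\<bar> < 2 * \<delta> \<and>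
      \<bar>real_of_rat (snd (B ! i)) - xs ! i\<bar> < 2 * \<delta>" for B
  proof (rule \<eta>(2)[OF box], clarify)
    fix a b assume "(a, b) \<in> set B"
    then obtain i where i: "i < n" "B ! i = (a, b)" using box by (auto simp: is_box_def in_set_conv_nth)
    have "\<bar>xs ! i\<bar> + 1 \<le> M" using i(1) len by (intro M(2)) simp
    then show "{of_rat a <..< of_rat b} \<subseteq> {-M..M} \<and> \<bar>real_of_rat a - of_rat b\<bar> < \<eta>"
      using near[OF i(1)] \<delta> unfolding i(2) by auto
  qed
  \<comment> \<open>The sides of \<open>C\<close> extend from \<open>xs\<close> by more than
    \<open>\<delta>\<close>, to contain the midpoints of every \<open>B\<close> near
    \<open>xs\<close>, and by less than \<open>2 * \<delta>\<close>, to be short themselves.\<close>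
  define lo where "lo x = (SOME q. x - 2 * \<delta> < of_rat q \<and> of_rat q < x - \<delta>)" for x
  define hi where "hi x = (SOME q. x + \<delta> < of_rat q \<and> of_rat q < x + 2 * \<delta>)" for x
  have lo: "x - 2 * \<delta> < of_rat (lo x) \<and> of_rat (lo x) < x - \<delta>" for x
    unfolding lo_def by (rule someI_ex) (use \<delta>(1) of_rat_dense[of "x - 2 * \<delta>" "x - \<delta>"] in auto)
  have hi: "x + \<delta> < of_rat (hi x) \<and> of_rat (hi x) < x + 2 * \<delta>" for x
    unfolding hi_def by (rule someI_ex) (use \<delta>(1) of_rat_dense[of "x + \<delta>" "x + 2 * \<delta>"] in auto)
  define C where "C = map (\<lambda>x. (lo x, hi x)) xs"
  have nth_C: "C ! i = (lo (xs ! i), hi (xs ! i))" if "i < n" for i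
    using that len by (simp add: C_def)
  have "lo x < hi x" for x
    using lo[of x] hi[of x] \<delta>(1) by (subst of_rat_less[where 'a = real, symmetric]) linarith
  then have boxC: "is_box n C" using len by (auto simp: is_box_def C_def)
  have narrowC: "\<bar>real_of_rat (fst (G C)) - of_rat (snd (G C))\<bar> < \<epsilon> / 2"
  proof (rule narrow[OF boxC])
    fix i assume "i < n"
    then show "\<bar>real_of_rat (fst (C ! i)) - xs ! i\<bar> < 2 * \<delta> \<and> \<bar>real_of_rat (snd (C ! i)) - xs ! i\<bar> < 2 * \<delta>"
      using lo[of "xs ! i"] hi[of "xs ! i"] \<delta>(1) by (simp add: nth_C)
  qed
  have "in_box xs C"
    unfolding in_box_def list_all2_conv_all_nth
  proof (intro conjI allI impI)
    fix i assume "i < length xs"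
    then show "case C ! i of (a, b) \<Rightarrow> xs ! i \<in> {of_rat a <..< of_rat b}"
      using lo[of "xs ! i"] hi[of "xs ! i"] \<delta>(1) len by (simp add: nth_C)
  qed (simp add: C_def)
  from G(2)[OF boxC this] have fxs: "f xs \<in> {of_rat (fst (G C)) <..< of_rat (snd (G C))}" .
  show thesis
  proof (rule that[OF \<delta>(1)])
    fix B J
    assume box: "is_box n B" and J: "tm_computes g (enc_box B) (enc_interval J)"
      and near: "\<forall>i<n. \<bar>real_of_rat (fst (B ! i)) - xs ! i\<bar> < \<delta> \<and> \<bar>real_of_rat (snd (B ! i)) - xs ! i\<bar> < \<delta>"
    have JB: "J = G B" using tm_computes_enc_interval_unique[OF J G(1)[OF box]] .
    have narrowB: "\<bar>real_of_rat (fst (G B)) - of_rat (snd (G B))\<bar> < \<epsilon> / 2"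
    proof (rule narrow[OF box])
      fix i assume "i < n"
      with near \<delta>(1) show "\<bar>real_of_rat (fst (B ! i)) - xs ! i\<bar> < 2 * \<delta> \<and> \<bar>real_of_rat (snd (B ! i)) - xs ! i\<bar> < 2 * \<delta>"
        by fastforce
    qed
    let ?ys = "map (\<lambda>I. (real_of_rat (fst I) + real_of_rat (snd I)) / 2) B"
    have inB: "in_box ?ys B" by (rule in_box_midpoints[OF box])
    have "in_box ?ys C"
      unfolding in_box_def list_all2_conv_all_nth
    proof (intro conjI allI impI)
      show lenC: "length ?ys = length C" using box boxC by (simp add: is_box_def)
      fix i assume "i < length ?ys"
      then have i: "i < n" using box by (simp add: is_box_def)
      then have "?ys ! i = (real_of_rat (fst (B ! i)) + real_of_rat (snd (B ! i))) / 2"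
        using box by (simp add: is_box_def)
      moreover have "\<bar>real_of_rat (fst (B ! i)) - xs ! i\<bar> < \<delta>" "\<bar>real_of_rat (snd (B ! i)) - xs ! i\<bar> < \<delta>"
        using near i by auto
      ultimately show "case C ! i of (a, b) \<Rightarrow> ?ys ! i \<in> {of_rat a <..< of_rat b}"
        using lo[of "xs ! i"] hi[of "xs ! i"] by (simp add: nth_C[OF i]; linarith)
    qed
    \<comment> \<open>Both outputs contain the value of \<open>f\<close> at the midpoints of
      \<open>B\<close>, and that of \<open>C\<close> contains \<open>f xs\<close>. The two lengths
      below \<open>\<epsilon> / 2\<close> add up to the distance \<open>\<epsilon>\<close>.\<close>
    from G(2)[OF boxC this] G(2)[OF box inB] fxs narrowC narrowB
    show "\<bar>real_of_rat (fst J) - f xs\<bar> < \<epsilon> \<and> \<bar>real_of_rat (snd J) - f xs\<bar> < \<epsilon>"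
      unfolding JB by auto
  qed
qed

lemma interval_mult:
  fixes a b c d x y r :: real
  assumes "a < x" "x < b" "c < y" "y < d"
    "r = (a * a + b * b + 1) * (d - c) + (c * c + 1) * (b - a)"
  shows "a * c - r < x * y \<and> x * y < a * c + r"
proof -
  \<comment> \<open>The square of \<open>\<bar>z\<bar> - 1 / 2\<close> is at least 0, which gives
    even \<open>\<bar>z\<bar> \<le> z * z + 1 / 4\<close>.\<close>
  have sq: "\<bar>z\<bar> < z * z + 1" for z :: real
    using zero_le_power2[of "\<bar>z\<bar> - 1 / 2"] by (simp add: power2_eq_square algebra_simps)
  have "\<bar>x\<bar> \<le> \<bar>a\<bar> \<or> \<bar>x\<bar> \<le> \<bar>b\<bar>" using assms by linarith
  then have x: "\<bar>x\<bar> \<le> a * a + b * b + 1"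
    using sq[of a] sq[of b] zero_le_square[of a] zero_le_square[of b] by linarith
  have "x * y - a * c = x * (y - c) + c * (x - a)" by (simp add: algebra_simps)
  also have "\<bar>\<dots>\<bar> \<le> \<bar>x\<bar> * (y - c) + \<bar>c\<bar> * (x - a)"
    using assms abs_triangle_ineq[of "x * (y - c)" "c * (x - a)"] by (simp add: abs_mult)
  also have "\<dots> < r"
  proof -
    have "\<bar>x\<bar> * (y - c) \<le> (a * a + b * b + 1) * (d - c)"
      using x assms by (intro mult_mono) auto
    moreover have "\<bar>c\<bar> * (x - a) \<le> \<bar>c\<bar> * (b - a)" "\<bar>c\<bar> * (b - a) < (c * c + 1) * (b - a)"
      using sq[of c] assms by (auto intro!: mult_left_mono mult_strict_right_mono)
    ultimately show ?thesis using assms(5) by linarith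
  qed
  finally show ?thesis by linarith
qed

text \<open>Existence and enclosure go together: an argument interval that contains a value is
  nonempty, so the arguments form a proper box, and only there is the code known to halt.\<close>

lemma ieval_enclosure:
  assumes "wf_term t" "\<And>x. x \<in> term_vars t \<Longrightarrow> \<exists>I. map_of E x = Some I \<and> inside (e x) I"
  shows "\<exists>I. ieval k E t I \<and> inside (term_val e t) I"
  using assms
proof (induction t)
  case (Var x)
  then show ?case by (auto intro: ieval.intros)
next
  case Zero
  show ?case
    by (intro exI conjI, rule ieval.intros) (auto simp: of_rat_minus of_rat_inverse_Suc simp del: of_nat_Suc minus_rat)
next
  case One
  show ?case
    by (intro exI conjI, rule ieval.intros)
      (auto simp: of_rat_diff of_rat_add of_rat_inverse_Suc simp del: of_nat_Suc minus_rat)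
next
  case (Add s t)
  then obtain I J where "ieval k E s I" "inside (term_val e s) I" "ieval k E t J" "inside (term_val e t) J"
    by auto
  then show ?case
    by (intro exI[of _ "(fst I + fst J, snd I + snd J)"]) (auto simp: of_rat_add intro: ieval.intros)
next
  case (Mul s t)
  then obtain a b c d where I: "ieval k E s (a, b)" "inside (term_val e s) (a, b)"
    "ieval k E t (c, d)" "inside (term_val e t) (c, d)"
    by auto
  let ?r = "(a * a + b * b + 1) * (d - c) + (c * c + 1) * (b - a)"
  have "ieval k E (Mul s t) (a * c - ?r, a * c + ?r)" using I by (auto intro: ieval.intros)
  moreover have "inside (term_val e (Mul s t)) (a * c - ?r, a * c + ?r)"
    using interval_mult[of "of_rat a" "term_val e s" "of_rat b" "of_rat c" "term_val e t" "of_rat d" "of_rat ?r"] I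
    by (simp add: of_rat_add of_rat_mult of_rat_diff)
  ultimately show ?case by blast
next
  case (Fun g ts)
  have "\<exists>I. ieval k E t I \<and> inside (term_val e t) I" if "t \<in> set ts" for t
    using that Fun.prems by (intro Fun.IH) auto
  then obtain f where f: "\<And>t. t \<in> set ts \<Longrightarrow> ieval k E t (f t)" "\<And>t. t \<in> set ts \<Longrightarrow> inside (term_val e t) (f t)"
    by metis
  have "fst (f t) < snd (f t)" if "t \<in> set ts" for t
    using f(2)[OF that] by (intro inside_nonempty)
  then have "is_box (length ts) (map f ts)" by (auto simp: is_box_def case_prod_unfold)
  from ecf_code_enclosure[OF wf_term_code[OF Fun.prems(1)] this]
  obtain J where J: "tm_computes g (enc_box (map f ts)) (enc_interval J)"
    "\<And>xs. in_box xs (map f ts) \<Longrightarrow> inside (ecf_fun g (length ts) xs) J" by blast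
  have "list_all2 (ieval k E) ts (map f ts)" using f(1) by (auto simp: list_all2_conv_all_nth)
  moreover have "in_box (map (term_val e) ts) (map f ts)"
    using f(2) by (auto simp: in_box_def list_all2_conv_all_nth case_prod_unfold)
  ultimately show ?case using J by (intro exI[of _ J]) (simp add: ieval.intros(6))
qed

text \<open>In an approximation no real values inside the intervals are given, so nonemptiness is
  proved on its own. It ensures that codes are applied to proper boxes.\<close>

lemma ieval_nonempty:
  assumes "ieval k E t I" "wf_term t" "\<And>x a b. x \<in> term_vars t \<Longrightarrow> map_of E x = Some (a, b) \<Longrightarrow> a < b"
  shows "fst I < snd I"
  using assms
proof induction
  case (1 x I)
  then show ?case by (cases I) auto
next
  case (4 s a b t c d)
  then show ?case by (force intro: add_strict_mono)
next
  case (5 s a b t c d r)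
  then have "a < b" "c < d" by auto
  moreover have "0 < a * a + b * b + 1" "0 < c * c + 1"
    by (simp_all add: add_nonneg_pos)
  ultimately have "0 < (a * a + b * b + 1) * (d - c)" "0 < (c * c + 1) * (b - a)" by simp_all
  then have "0 < r" using 5 by linarith
  then show ?case by simp
next
  case (6 ts Is g J)
  have "is_box (length ts) Is"
    using 6 by (auto simp: is_box_def list_all2_conv_all_nth in_set_conv_nth) (metis fst_conv nth_mem snd_conv)
  \<comment> \<open>The output is nonempty because it encloses the value at the midpoints;
    uniqueness of outputs transfers this to \<open>J\<close>.\<close>
  from ecf_code_enclosure[OF wf_term_code[OF 6(3)] this] in_box_midpoints[OF this]
  obtain J' x where "tm_computes g (enc_box Is) (enc_interval J')" "inside x J'" by metis
  with 6(2) tm_computes_enc_interval_unique have "inside x J" by blast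
  then show ?case by (rule inside_nonempty)
qed (simp_all add: Zero_rat_def)

section \<open>Limits of approximations\<close>

definition tends_to_point :: "(nat \<Rightarrow> interval) \<Rightarrow> real \<Rightarrow> bool" where
  "tends_to_point I x \<longleftrightarrow>
     (\<lambda>n. real_of_rat (fst (I n))) \<longlonglongrightarrow> x \<and> (\<lambda>n. real_of_rat (snd (I n))) \<longlonglongrightarrow> x"

lemma tends_to_point_subseq:
  "tends_to_point I x \<Longrightarrow> strict_mono r \<Longrightarrow> tends_to_point (\<lambda>n. I (r n)) x"
  using LIMSEQ_subseq_LIMSEQ[of _ x r] unfolding tends_to_point_def comp_def by blast

lemma ieval_tends_to:
  assumes "wf_term t" "filterlim \<kappa> at_top sequentially"
    and "\<And>x. x \<in> term_vars t \<Longrightarrow>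
      \<exists>J. (\<forall>n. map_of (E n) x = Some (J n) \<and> fst (J n) < snd (J n)) \<and> tends_to_point J (e x)"
    and "\<And>n. ieval (\<kappa> n) (E n) t (I n)"
  shows "tends_to_point I (term_val e t)"
  using assms(1,3,4)
proof (induction t arbitrary: I)
  case (Var x)
  then obtain J where "\<forall>n. map_of (E n) x = Some (J n)" "tends_to_point J (e x)" by auto
  moreover have "map_of (E n) x = Some (I n)" for n
    using Var(3)[of n] by cases auto
  ultimately have "I = J" by auto
  with \<open>tends_to_point J (e x)\<close> show ?case by simp
next
  case Zero
  have I: "I n = (- Fract 1 (int (Suc (\<kappa> n))), Fract 1 (int (Suc (\<kappa> n))))" for n
    using Zero(3)[of n] by cases auto
  have "(\<lambda>n. 1 / (real (\<kappa> n) + 1)) \<longlonglongrightarrow> 0"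
    using filterlim_compose[OF LIMSEQ_inverse_real_of_nat assms(2)] by (simp add: inverse_eq_divide add.commute)
  from this tendsto_minus[OF this] show ?case
    unfolding tends_to_point_def I by (simp add: of_rat_minus of_rat_inverse_Suc del: minus_rat of_nat_Suc)
next
  case One
  have I: "I n = (1 - Fract 1 (int (Suc (\<kappa> n))), 1 + Fract 1 (int (Suc (\<kappa> n))))" for n
    using One(3)[of n] by cases auto
  have "(\<lambda>n. 1 / (real (\<kappa> n) + 1)) \<longlonglongrightarrow> 0"
    using filterlim_compose[OF LIMSEQ_inverse_real_of_nat assms(2)] by (simp add: inverse_eq_divide add.commute)
  from tendsto_diff[OF tendsto_const[of 1] this] tendsto_add[OF tendsto_const[of 1] this] show ?case
    unfolding tends_to_point_def I
    by (simp add: of_rat_diff of_rat_add of_rat_inverse_Suc del: minus_rat of_nat_Suc)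
next
  case (Add s t)
  have "\<exists>J K. ieval (\<kappa> n) (E n) s J \<and> ieval (\<kappa> n) (E n) t K \<and> I n = (fst J + fst K, snd J + snd K)" for n
    using Add(5)[of n] by cases auto
  then obtain J K where JK: "\<And>n. ieval (\<kappa> n) (E n) s (J n)" "\<And>n. ieval (\<kappa> n) (E n) t (K n)"
    "\<And>n. I n = (fst (J n) + fst (K n), snd (J n) + snd (K n))" by metis
  have "tends_to_point J (term_val e s)" using Add.prems JK by (intro Add.IH(1)) auto
  moreover have "tends_to_point K (term_val e t)" using Add.prems JK by (intro Add.IH(2)) auto
  ultimately show ?case
    unfolding tends_to_point_def JK by (auto simp: of_rat_add intro!: tendsto_intros)
next
  case (Mul s t)
  let ?r = "\<lambda>J K :: interval. (fst J * fst J + snd J * snd J + 1) * (snd K - fst K)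
    + (fst K * fst K + 1) * (snd J - fst J)"
  have "\<exists>J K. ieval (\<kappa> n) (E n) s J \<and> ieval (\<kappa> n) (E n) t K \<and>
      I n = (fst J * fst K - ?r J K, fst J * fst K + ?r J K)" for n
    using Mul(5)[of n] by cases auto
  then obtain J K where JK: "\<And>n. ieval (\<kappa> n) (E n) s (J n)" "\<And>n. ieval (\<kappa> n) (E n) t (K n)"
    "\<And>n. I n = (fst (J n) * fst (K n) - ?r (J n) (K n), fst (J n) * fst (K n) + ?r (J n) (K n))"
    by metis
  have J: "tends_to_point J (term_val e s)" using Mul.prems JK by (intro Mul.IH(1)) auto
  have K: "tends_to_point K (term_val e t)" using Mul.prems JK by (intro Mul.IH(2)) auto
  let ?x = "term_val e s" and ?y = "term_val e t"
  \<comment> \<open>Both interval lengths tend to 0, so this limit vanishes; it is kept in the form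
    that the limit rules produce.\<close>
  have r: "(\<lambda>n. real_of_rat (?r (J n) (K n))) \<longlonglongrightarrow> (?x * ?x + ?x * ?x + 1) * (?y - ?y) + (?y * ?y + 1) * (?x - ?x)"
    using J K unfolding tends_to_point_def of_rat_add of_rat_mult of_rat_diff of_rat_1
    by (intro tendsto_intros) auto
  have p: "(\<lambda>n. real_of_rat (fst (J n) * fst (K n))) \<longlonglongrightarrow> ?x * ?y"
    using J K unfolding tends_to_point_def of_rat_mult by (intro tendsto_intros) auto
  show ?case
    using tendsto_diff[OF p r] tendsto_add[OF p r]
    unfolding tends_to_point_def JK fst_conv snd_conv of_rat_diff[of "_ * _"] of_rat_add[of "fst _ * fst _"]
    by (simp add: of_rat_add of_rat_diff)
next
  case (Fun g ts)
  have "\<exists>Js. list_all2 (ieval (\<kappa> n) (E n)) ts Js \<and> tm_computes g (enc_box Js) (enc_interval (I n))" for n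
    using Fun(4)[of n] by cases auto
  then obtain Js where Js: "\<And>n. list_all2 (ieval (\<kappa> n) (E n)) ts (Js n)"
    "\<And>n. tm_computes g (enc_box (Js n)) (enc_interval (I n))" by metis
  have wf: "wf_term t" if "t \<in> set ts" for t using Fun.prems(1) that by auto
  have box: "is_box (length ts) (Js n)" for n
  proof -
    have "fst (Js n ! i) < snd (Js n ! i)" if "i < length ts" for i
    proof (rule ieval_nonempty)
      show "ieval (\<kappa> n) (E n) (ts ! i) (Js n ! i)"
        using Js(1)[of n] that by (auto simp: list_all2_conv_all_nth)
      show "wf_term (ts ! i)" using wf that by simp
      fix x a b assume "x \<in> term_vars (ts ! i)" "map_of (E n) x = Some (a, b)"
      moreover from this that have "x \<in> term_vars (Fun g ts)" by auto
      with Fun.prems(2) obtain J where "\<forall>n. map_of (E n) x = Some (J n) \<and> fst (J n) < snd (J n)"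
        by blast
      ultimately show "a < b" by (metis fst_conv option.inject snd_conv)
    qed
    with Js(1)[of n] show ?thesis
      by (auto simp: is_box_def list_all2_conv_all_nth in_set_conv_nth) (metis fst_conv snd_conv)
  qed
  have lim: "tends_to_point (\<lambda>n. Js n ! i) (map (term_val e) ts ! i)" if "i < length ts" for i
  proof -
    have "tends_to_point (\<lambda>n. Js n ! i) (term_val e (ts ! i))"
    proof (rule Fun.IH)
      show "ts ! i \<in> set ts" using that by simp
      then show "wf_term (ts ! i)" by (rule wf)
      show "ieval (\<kappa> n) (E n) (ts ! i) (Js n ! i)" for n
        using Js(1)[of n] that by (auto simp: list_all2_conv_all_nth)
      show "\<exists>J. (\<forall>n. map_of (E n) x = Some (J n) \<and> fst (J n) < snd (J n)) \<and> tends_to_point J (e x)"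
        if "x \<in> term_vars (ts ! i)" for x
        using that \<open>ts ! i \<in> set ts\<close> by (intro Fun.prems(2)) auto
    qed
    with that show ?thesis by simp
  qed
  let ?f = "ecf_fun g (length ts)" and ?xs = "map (term_val e) ts"
  have "\<forall>\<^sub>F n in sequentially. \<bar>real_of_rat (fst (I n)) - ?f ?xs\<bar> < \<epsilon> \<and> \<bar>real_of_rat (snd (I n)) - ?f ?xs\<bar> < \<epsilon>"
    if "\<epsilon> > 0" for \<epsilon>
  proof -
    from ecf_code_near[OF wf_term_code[OF Fun.prems(1)] length_map that, of "term_val e"]
    obtain \<delta> where \<delta>: "\<delta> > 0"
      "\<And>B J. is_box (length ts) B \<Longrightarrow> tm_computes g (enc_box B) (enc_interval J) \<Longrightarrow>
         \<forall>i<length ts. \<bar>real_of_rat (fst (B ! i)) - ?xs ! i\<bar> < \<delta> \<and> \<bar>real_of_rat (snd (B ! i)) - ?xs ! i\<bar> < \<delta> \<Longrightarrow>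
         \<bar>real_of_rat (fst J) - ?f ?xs\<bar> < \<epsilon> \<and> \<bar>real_of_rat (snd J) - ?f ?xs\<bar> < \<epsilon>" by metis
    have "\<forall>\<^sub>F n in sequentially. \<forall>i\<in>{..<length ts}.
        \<bar>real_of_rat (fst (Js n ! i)) - ?xs ! i\<bar> < \<delta> \<and> \<bar>real_of_rat (snd (Js n ! i)) - ?xs ! i\<bar> < \<delta>"
    proof (intro eventually_ball_finite ballI eventually_conj)
      fix i assume "i \<in> {..<length ts}"
      with lim have "tends_to_point (\<lambda>n. Js n ! i) (?xs ! i)" by simp
      with \<delta>(1) show "\<forall>\<^sub>F n in sequentially. \<bar>real_of_rat (fst (Js n ! i)) - ?xs ! i\<bar> < \<delta>"
        "\<forall>\<^sub>F n in sequentially. \<bar>real_of_rat (snd (Js n ! i)) - ?xs ! i\<bar> < \<delta>"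
        unfolding tends_to_point_def by (auto simp: tendsto_iff dist_real_def)
    qed simp
    then show ?thesis
      by (rule eventually_mono) (use \<delta>(2)[OF box Js(2)] in auto)
  qed
  then show ?case
    unfolding tends_to_point_def tendsto_iff dist_real_def term_val.simps eventually_conj_iff by blast
qed

lemma frequently_subseq:
  assumes "\<exists>\<^sub>F n in sequentially. P n"
  obtains r :: "nat \<Rightarrow> nat" where "strict_mono r" "\<And>n. P (r n)"
proof -
  have "infinite {n. P n}" using assms by (simp add: INFM_iff_infinite flip: cofinite_eq_sequentially)
  from infinite_enumerate[OF this] show thesis using that by auto
qed

text \<open>The bound \<open>m\<close> stays fixed while the precision grows. Disjunctions and
  quantifiers pass to subsequences, so the induction has to admit arbitrary diverging precisions
  \<open>\<kappa>\<close> and environments \<open>E\<close>.\<close>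

lemma approx_imp_holds:
  assumes "wf_form \<phi>" "filterlim \<kappa> at_top sequentially"
    and "\<And>x. x \<in> free_vars \<phi> \<Longrightarrow>
      \<exists>J. (\<forall>n. map_of (E n) x = Some (J n) \<and> fst (J n) < snd (J n)) \<and> tends_to_point J (e x)"
    and "\<And>n. approx m (\<kappa> n) \<phi> (E n)"
  shows "holds e \<phi>"
  using assms
proof (induction \<phi> arbitrary: \<kappa> E e)
  case (Less s t)
  have "\<forall>n. \<exists>I J. ieval (\<kappa> n) (E n) s I \<and> ieval (\<kappa> n) (E n) t J \<and> fst I + Fract 1 (int (Suc m)) < snd J"
    using Less(4) by simp
  then obtain I J where IJ: "\<And>n. ieval (\<kappa> n) (E n) s (I n)" "\<And>n. ieval (\<kappa> n) (E n) t (J n)"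
    "\<And>n. fst (I n) + Fract 1 (int (Suc m)) < snd (J n)" by metis
  have I: "tends_to_point I (term_val e s)"
    using Less.prems IJ by (intro ieval_tends_to[of s \<kappa> E]) auto
  have J: "tends_to_point J (term_val e t)"
    using Less.prems IJ by (intro ieval_tends_to[of t \<kappa> E]) auto
  have "real_of_rat (fst (I n)) + 1 / (real m + 1) \<le> real_of_rat (snd (J n))" for n
    using IJ(3)[of n, folded of_rat_less[where 'a = real]] by (simp add: of_rat_add of_rat_inverse_Suc del: of_nat_Suc)
  \<comment> \<open>Only a weak inequality survives the limit; the fixed margin makes it strict
    again.\<close>
  then have "term_val e s + 1 / (real m + 1) \<le> term_val e t"
    using LIMSEQ_le[OF tendsto_add[OF _ tendsto_const], of "\<lambda>n. real_of_rat (fst (I n))"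
        "term_val e s" "\<lambda>n. real_of_rat (snd (J n))" "term_val e t" "1 / (real m + 1)"] I J
    unfolding tends_to_point_def by blast
  moreover have "0 < 1 / (real m + 1)" by simp
  ultimately show ?case unfolding holds.simps by linarith
next
  case (Equal s t)
  have "\<forall>n. \<exists>I J. ieval (\<kappa> n) (E n) s I \<and> ieval (\<kappa> n) (E n) t J \<and> fst I < snd J \<and> fst J < snd I"
    using Equal(4) by simp
  then obtain I J where IJ: "\<And>n. ieval (\<kappa> n) (E n) s (I n)" "\<And>n. ieval (\<kappa> n) (E n) t (J n)"
    "\<And>n. fst (I n) < snd (J n)" "\<And>n. fst (J n) < snd (I n)" by metis
  have I: "tends_to_point I (term_val e s)"
    using Equal.prems IJ by (intro ieval_tends_to[of s \<kappa> E]) auto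
  have J: "tends_to_point J (term_val e t)"
    using Equal.prems IJ by (intro ieval_tends_to[of t \<kappa> E]) auto
  have "real_of_rat (fst (I n)) \<le> real_of_rat (snd (J n))" "real_of_rat (fst (J n)) \<le> real_of_rat (snd (I n))" for n
    using IJ(3,4)[of n] by (simp_all add: of_rat_less_eq)
  then have "term_val e s \<le> term_val e t" "term_val e t \<le> term_val e s"
    using LIMSEQ_le[of "\<lambda>n. real_of_rat (fst (I n))" "term_val e s" "\<lambda>n. real_of_rat (snd (J n))" "term_val e t"]
      LIMSEQ_le[of "\<lambda>n. real_of_rat (fst (J n))" "term_val e t" "\<lambda>n. real_of_rat (snd (I n))" "term_val e s"] I J
    unfolding tends_to_point_def by blast+
  then show ?case by simp
next
  case (Conj \<phi> \<psi>)
  have "holds e \<phi>"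
    using Conj.prems(1,3,4) by (intro Conj.IH(1)[OF _ Conj.prems(2), of E]) simp_all
  moreover have "holds e \<psi>"
    using Conj.prems(1,3,4) by (intro Conj.IH(2)[OF _ Conj.prems(2), of E]) simp_all
  ultimately show ?case by simp
next
  case (Disj \<phi> \<psi>)
  have "(\<exists>\<^sub>F n in sequentially. approx m (\<kappa> n) \<phi> (E n)) \<or> (\<exists>\<^sub>F n in sequentially. approx m (\<kappa> n) \<psi> (E n))"
    using Disj.prems(4) unfolding frequently_disj_iff[symmetric] by simp
  \<comment> \<open>By the pigeonhole principle one disjunct is approximately true infinitely often,
    though perhaps not at every precision.\<close>
  then obtain \<chi> where \<chi>: "\<chi> \<in> {\<phi>, \<psi>}" "\<exists>\<^sub>F n in sequentially. approx m (\<kappa> n) \<chi> (E n)" by blast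
  obtain r :: "nat \<Rightarrow> nat" where r: "strict_mono r" "\<And>n. approx m (\<kappa> (r n)) \<chi> (E (r n))"
    by (rule frequently_subseq[OF \<chi>(2)]) (rule that)
  have lim: "filterlim (\<lambda>n. \<kappa> (r n)) at_top sequentially"
    using filterlim_compose[OF Disj.prems(2) filterlim_subseq[OF r(1)]] .
  have vars: "\<exists>J. (\<forall>n. map_of (E (r n)) x = Some (J n) \<and> fst (J n) < snd (J n)) \<and> tends_to_point J (e x)"
    if x: "x \<in> free_vars (Disj \<phi> \<psi>)" for x
  proof -
    obtain J where "\<forall>n. map_of (E n) x = Some (J n) \<and> fst (J n) < snd (J n)" "tends_to_point J (e x)"
      using Disj.prems(3)[OF x] by blast
    with tends_to_point_subseq[OF _ r(1)] show ?thesis by (intro exI[of _ "\<lambda>n. J (r n)"]) simp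
  qed
  have "holds e \<phi>" if "\<chi> = \<phi>"
    using Disj.prems(1) vars r(2) unfolding that by (intro Disj.IH(1)[OF _ lim, of "\<lambda>n. E (r n)"]) auto
  moreover have "holds e \<psi>" if "\<chi> = \<psi>"
    using Disj.prems(1) vars r(2) unfolding that by (intro Disj.IH(2)[OF _ lim, of "\<lambda>n. E (r n)"]) auto
  ultimately show ?case using \<chi>(1) by auto
next
  case (Exists y \<phi>)
  have "\<forall>n. \<exists>a b. 0 < of_nat m + a \<and> b < of_nat m \<and> a < b \<and> b < a + Fract 1 (int (Suc (\<kappa> n))) \<and>
      approx m (\<kappa> n) \<phi> ((y, (a, b)) # E n)"
    using Exists.prems(4) by simp
  then obtain a b where ab: "\<And>n. 0 < of_nat m + a n" "\<And>n. b n < of_nat m" "\<And>n. a n < b n"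
    "\<And>n. b n < a n + Fract 1 (int (Suc (\<kappa> n)))" "\<And>n. approx m (\<kappa> n) \<phi> ((y, (a n, b n)) # E n)"
    by metis
  let ?a = "\<lambda>n. real_of_rat (a n)" and ?b = "\<lambda>n. real_of_rat (b n)"
  have real_ab: "- real m < ?a n" "?b n < real m" "?a n < ?b n" "?b n < ?a n + 1 / (real (\<kappa> n) + 1)" for n
    using ab(1-4)[of n, folded of_rat_less[where 'a = real]]
    by (simp_all add: of_rat_add of_rat_inverse_Suc del: of_nat_Suc)
  \<comment> \<open>The bound \<open>m\<close> keeps the left endpoints bounded, so a monotone
    subsequence of them converges; the right endpoints follow because the lengths tend to 0.\<close>
  obtain r :: "nat \<Rightarrow> nat" where r: "strict_mono r" "monoseq (\<lambda>n. ?a (r n))"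
    using seq_monosub[of ?a] by (elim exE conjE) (rule that)
  have "Bseq (\<lambda>n. ?a (r n))"
  proof (rule BseqI')
    show "norm (?a (r n)) \<le> real m" for n
      using real_ab[of "r n"] unfolding real_norm_def by linarith
  qed
  with r(2) obtain v where v: "(\<lambda>n. ?a (r n)) \<longlonglongrightarrow> v"
    using Bseq_monoseq_convergent convergent_def by blast
  have lim: "filterlim (\<lambda>n. \<kappa> (r n)) at_top sequentially"
    using filterlim_compose[OF Exists.prems(2) filterlim_subseq[OF r(1)]] .
  have "(\<lambda>n. 1 / (real (\<kappa> (r n)) + 1)) \<longlonglongrightarrow> 0"
    using filterlim_compose[OF LIMSEQ_inverse_real_of_nat lim] by (simp add: inverse_eq_divide add.commute)
  from tendsto_add[OF v this]
  have upper: "(\<lambda>n. ?a (r n) + 1 / (real (\<kappa> (r n)) + 1)) \<longlonglongrightarrow> v" by simp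
  have "(\<lambda>n. ?b (r n)) \<longlonglongrightarrow> v"
  proof (rule tendsto_sandwich[OF _ _ v upper])
    show "\<forall>\<^sub>F n in sequentially. ?a (r n) \<le> ?b (r n)"
      using real_ab(3) by (intro always_eventually allI less_imp_le)
    show "\<forall>\<^sub>F n in sequentially. ?b (r n) \<le> ?a (r n) + 1 / (real (\<kappa> (r n)) + 1)"
      using real_ab(4) by (intro always_eventually allI less_imp_le)
  qed
  with v have y: "tends_to_point (\<lambda>n. (a (r n), b (r n))) v" by (simp add: tends_to_point_def)
  have "holds (e(y := v)) \<phi>"
  proof (rule Exists.IH[OF _ lim])
    show "wf_form \<phi>" using Exists.prems(1) by simp
    show "approx m (\<kappa> (r n)) \<phi> ((y, (a (r n), b (r n))) # E (r n))" for n by (rule ab(5))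
    fix x assume x: "x \<in> free_vars \<phi>"
    show "\<exists>J. (\<forall>n. map_of ((y, (a (r n), b (r n))) # E (r n)) x = Some (J n) \<and> fst (J n) < snd (J n)) \<and>
        tends_to_point J ((e(y := v)) x)"
    proof (cases "x = y")
      case True
      with y ab(3) show ?thesis by (intro exI[of _ "\<lambda>n. (a (r n), b (r n))"]) auto
    next
      case False
      with x Exists.prems(3)[of x] obtain J where
        "\<forall>n. map_of (E n) x = Some (J n) \<and> fst (J n) < snd (J n)" "tends_to_point J (e x)" by auto
      with False tends_to_point_subseq[OF _ r(1)] show ?thesis
        by (intro exI[of _ "\<lambda>n. J (r n)"]) simp
    qed
  qed
  then show ?case by auto
qed

lemma holds_imp_approx:
  assumes "wf_form \<phi>" "holds e \<phi>"
  shows "\<exists>m\<^sub>0. \<forall>m\<ge>m\<^sub>0. \<forall>k E. (\<forall>x\<in>free_vars \<phi>. \<exists>I. map_of E x = Some I \<and> inside (e x) I) \<longrightarrow> approx m k \<phi> E"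
  using assms
proof (induction \<phi> arbitrary: e)
  case (Less s t)
  then have "0 < term_val e t - term_val e s" by simp
  \<comment> \<open>The margin has to fit into the true gap between the two sides; passing to outer
    endpoints of enclosures only widens that gap, whatever the precision.\<close>
  then obtain m\<^sub>0 where m\<^sub>0: "inverse (real (Suc m\<^sub>0)) < term_val e t - term_val e s"
    using reals_Archimedean by blast
  show ?case
  proof (intro exI[of _ m\<^sub>0] allI impI)
    fix m k E
    assume m: "m\<^sub>0 \<le> m" and E: "\<forall>x\<in>free_vars (Less s t). \<exists>I. map_of E x = Some I \<and> inside (e x) I"
    obtain I where I: "ieval k E s I" "inside (term_val e s) I"
      using ieval_enclosure[of s E e k] Less.prems(1) E by auto
    obtain J where J: "ieval k E t J" "inside (term_val e t) J"
      using ieval_enclosure[of t E e k] Less.prems(1) E by auto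
    have "1 / (real m + 1) \<le> inverse (real (Suc m\<^sub>0))"
      using m by (simp add: inverse_eq_divide frac_le)
    with m\<^sub>0 I(2) J(2) have "real_of_rat (fst I + Fract 1 (int (Suc m))) < real_of_rat (snd J)"
      unfolding of_rat_add of_rat_inverse_Suc by linarith
    then have "fst I + Fract 1 (int (Suc m)) < snd J" unfolding of_rat_less .
    with I J show "approx m k (Less s t) E" unfolding approx.simps by blast
  qed
next
  case (Equal s t)
  have "approx m k (Equal s t) E"
    if E: "\<forall>x\<in>free_vars (Equal s t). \<exists>I. map_of E x = Some I \<and> inside (e x) I" for m k E
  proof -
    obtain I where I: "ieval k E s I" "inside (term_val e s) I"
      using ieval_enclosure[of s E e k] Equal.prems(1) E by auto
    obtain J where J: "ieval k E t J" "inside (term_val e t) J"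
      using ieval_enclosure[of t E e k] Equal.prems(1) E by auto
    have "fst I < snd J" "fst J < snd I"
      using I(2) J(2) Equal.prems(2)
        of_rat_less[where 'a = real, of "fst I" "snd J"] of_rat_less[where 'a = real, of "fst J" "snd I"]
      by auto
    with I J show ?thesis unfolding approx.simps by blast
  qed
  then show ?case by blast
next
  case (Conj \<phi> \<psi>)
  let ?P = "\<lambda>m \<phi>. \<forall>k E. (\<forall>x\<in>free_vars \<phi>. \<exists>I. map_of E x = Some I \<and> inside (e x) I) \<longrightarrow> approx m k \<phi> E"
  have wf: "wf_form \<phi>" "wf_form \<psi>" and hold: "holds e \<phi>" "holds e \<psi>" using Conj.prems by simp_all
  from Conj.IH(1)[OF wf(1) hold(1)] obtain i where i: "\<forall>m\<ge>i. ?P m \<phi>" ..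
  from Conj.IH(2)[OF wf(2) hold(2)] obtain j where j: "\<forall>m\<ge>j. ?P m \<psi>" ..
  have "\<forall>m\<ge>max i j. ?P m (Conj \<phi> \<psi>)" using i j by simp
  then show ?case ..
next
  case (Disj \<phi> \<psi>)
  let ?P = "\<lambda>m \<phi>. \<forall>k E. (\<forall>x\<in>free_vars \<phi>. \<exists>I. map_of E x = Some I \<and> inside (e x) I) \<longrightarrow> approx m k \<phi> E"
  from Disj.prems have "holds e \<phi> \<or> holds e \<psi>" by simp
  then show ?case
  proof
    assume hold: "holds e \<phi>"
    have "wf_form \<phi>" using Disj.prems(1) by simp
    from Disj.IH(1)[OF this hold] obtain i where "\<forall>m\<ge>i. ?P m \<phi>" ..
    then have "\<forall>m\<ge>i. ?P m (Disj \<phi> \<psi>)" by simp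
    then show ?thesis ..
  next
    assume hold: "holds e \<psi>"
    have "wf_form \<psi>" using Disj.prems(1) by simp
    from Disj.IH(2)[OF this hold] obtain i where "\<forall>m\<ge>i. ?P m \<psi>" ..
    then have "\<forall>m\<ge>i. ?P m (Disj \<phi> \<psi>)" by simp
    then show ?thesis ..
  qed
next
  case (Exists y \<phi>)
  then obtain v where hold: "holds (e(y := v)) \<phi>" by auto
  have "wf_form \<phi>" using Exists.prems(1) by simp
  from Exists.IH[OF this hold] obtain i where i: "\<forall>m\<ge>i. \<forall>k E.
      (\<forall>x\<in>free_vars \<phi>. \<exists>I. map_of E x = Some I \<and> inside ((e(y := v)) x) I) \<longrightarrow> approx m k \<phi> E" ..
  \<comment> \<open>The margin 1 leaves room for rational endpoints at distance less than 1 from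
    \<open>v\<close>; below, \<open>w\<close> is half the length allowed by the precision.\<close>
  obtain j where j: "\<bar>v\<bar> + 1 \<le> real j" using real_arch_simple by blast
  show ?case
  proof (intro exI[of _ "max i j"] allI impI)
    fix m k E
    assume m: "max i j \<le> m"
      and E: "\<forall>x\<in>free_vars (Exists y \<phi>). \<exists>I. map_of E x = Some I \<and> inside (e x) I"
    have m': "\<bar>v\<bar> + 1 \<le> real m" using j m by (meson max.boundedE of_nat_mono order_trans)
    define w where "w = 1 / (2 * (real k + 1))"
    have w: "0 < w" "w < 1" "2 * w = 1 / (real k + 1)" by (auto simp: w_def field_simps)
    obtain a where a: "v - w < of_rat a" "of_rat a < v" using of_rat_dense[of "v - w" v] w by auto
    obtain b where b: "v < of_rat b" "of_rat b < v + w" using of_rat_dense[of v "v + w"] w by auto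
    have "real_of_rat 0 < real_of_rat (of_nat m + a)" "real_of_rat b < real_of_rat (of_nat m)"
      "real_of_rat a < real_of_rat b" "real_of_rat b < real_of_rat (a + Fract 1 (int (Suc k)))"
      unfolding of_rat_add of_rat_inverse_Suc of_rat_of_nat_eq of_rat_0 using a b m' w by linarith+
    then have "0 < of_nat m + a" "b < of_nat m" "a < b" "b < a + Fract 1 (int (Suc k))"
      unfolding of_rat_less by simp_all
    moreover have "approx m k \<phi> ((y, (a, b)) # E)"
      using m E a b by (intro i[rule_format]) auto
    ultimately show "approx m k (Exists y \<phi>) E" by auto
  qed
qed

section \<open>The criterion for truth and its Sigma-3 form\<close>

lemma true_sentence_iff:
  assumes "ecf_sentence \<phi>"
  shows "true_sentence \<phi> \<longleftrightarrow> (\<exists>m. \<forall>k. approx m k \<phi> [])"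
proof -
  have wf: "wf_form \<phi>" and closed: "free_vars \<phi> = {}" using assms by (auto simp: ecf_sentence_def)
  have "holds e \<phi>" if "\<And>k. approx m k \<phi> []" for e m
    using wf closed that by (intro approx_imp_holds[of \<phi> "\<lambda>n. n" "\<lambda>_. []" e m]) (auto simp: filterlim_ident)
  moreover have "\<exists>m. \<forall>k. approx m k \<phi> []" if "holds e \<phi>" for e
  proof -
    from holds_imp_approx[OF wf that] closed obtain m where "\<forall>k E. approx m k \<phi> E" by auto
    then show ?thesis by blast
  qed
  ultimately show ?thesis using assms unfolding true_sentence_def by blast
qed

text \<open>With the arguments in variables 0, 1 and 2 the matrix has level Sigma-1; the universal
  quantifier leads to Pi-2 and the existential one to Sigma-3.\<close>

lemma re_sigma_set_3:
  fixes P :: "nat \<Rightarrow> nat \<Rightarrow> nat \<Rightarrow> bool"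
  assumes "re (\<lambda>p. P (fst p) (fst (snd p)) (snd (snd p)))"
  shows "sigma_set 3 {n. \<exists>m. \<forall>k. P n m k}"
proof -
  let ?A = "godel ` {p. P (fst p) (fst (snd p)) (snd (snd p))}"
  have "pos_form (AEx 3 (AEx 4 (AConj (pair_form (AVar 1) (AVar 2) (AVar 3))
      (AConj (pair_form (AVar 0) (AVar 3) (AVar 4)) (mem 4 ?A)))))"
    using assms by (simp add: re_def mem_form)
  from pos_form_sigma_form[OF this] obtain \<psi> where \<psi>: "sigma_form 1 \<psi>"
    "\<And>e. arith_holds e \<psi> \<longleftrightarrow> prod_encode (e 0, prod_encode (e 1, e 2)) \<in> ?A"
    using assms by (auto simp: re_def mem_form)
  have "prod_encode (n, prod_encode (m, k)) \<in> ?A \<longleftrightarrow> P n m k" for n m k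
    by (force simp: image_iff)
  with \<psi>(2) have "arith_holds e (AEx 1 (AAll 2 \<psi>)) \<longleftrightarrow> e 0 \<in> {n. \<exists>m. \<forall>k. P n m k}" for e
    by simp
  moreover have "sigma_form (Suc (Suc (Suc 0))) (AEx 1 (AAll 2 \<psi>))"
    using \<psi>(1) by (intro sigma_form_pi_form.intros(4)[OF sigma_form_pi_form.intros(3)]
        sigma_form_pi_form.intros(6)[OF sigma_form_pi_form.intros(5)]) simp
  ultimately show ?thesis
    unfolding sigma_set_def numeral_3_eq_3 by blast
qed

theorem theorem11: "ExistsR_ECF \<subseteq> Sigma0 3"
proof
  fix L assume "L \<in> ExistsR_ECF"
  then obtain r where "poly_time r" and inst: "\<And>w. r w \<in> enc_form ` {\<phi>. ecf_sentence \<phi>}"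
    and red: "\<And>w. w \<in> L \<longleftrightarrow> r w \<in> enc_form ` {\<phi>. true_sentence \<phi>}"
    unfolding ExistsR_ECF_def poly_reducible_def by auto
  then obtain M where "\<And>w. tm_computes M w (r w)"
    unfolding poly_time_def tm_computes_def by blast
  \<comment> \<open>Machines are deterministic, so the enumerable relation
    \<open>tm_computes M\<close> is the graph of \<open>r\<close>.\<close>
  then have M: "tm_computes M w v \<longleftrightarrow> v = r w" for w v
    using tm_computes_unique by blast
  \<comment> \<open>The quantifier over \<open>\<phi>\<close> decodes the output of the reduction.
    That \<open>\<phi>\<close> is a sentence holds because every output of \<open>r\<close> is an
    instance.\<close>
  let ?P = "\<lambda>n m k. \<exists>w \<phi>. str_code w = n \<and> tm_computes M w (enc_form \<phi>) \<and> approx m k \<phi> []"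
  have "n \<in> str_code ` L \<longleftrightarrow> (\<exists>m. \<forall>k. ?P n m k)" for n
  proof -
    obtain w where w: "n = str_code w" using bij_str_code by (metis bij_pointE)
    obtain \<phi> where \<phi>: "r w = enc_form \<phi>" "ecf_sentence \<phi>" using inst[of w] by blast
    have "n \<in> str_code ` L \<longleftrightarrow> w \<in> L" using bij_str_code unfolding w by (simp add: bij_is_inj inj_image_mem_iff)
    also have "\<dots> \<longleftrightarrow> true_sentence \<phi>" unfolding red \<phi>(1) using inj_enc_form by (auto dest: injD)
    also have "\<dots> \<longleftrightarrow> (\<exists>m. \<forall>k. approx m k \<phi> [])" by (rule true_sentence_iff[OF \<phi>(2)])
    finally have "n \<in> str_code ` L \<longleftrightarrow> (\<exists>m. \<forall>k. approx m k \<phi> [])" .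
    moreover have "?P n m k \<longleftrightarrow> approx m k \<phi> []" for m k
      by (auto simp: w M \<phi>(1) inj_eq[OF bij_is_inj[OF bij_str_code]] inj_eq[OF inj_enc_form])
    ultimately show ?thesis by simp
  qed
  then have "str_code ` L = {n. \<exists>m. \<forall>k. ?P n m k}" by blast
  moreover have "re (\<lambda>p. ?P (fst p) (fst (snd p)) (snd (snd p)))" by (intro comp)
  then have "sigma_set 3 {n. \<exists>m. \<forall>k. ?P n m k}" by (rule re_sigma_set_3)
  ultimately show "L \<in> Sigma0 3" by (simp add: Sigma0_def)
qed

end
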